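(* Let $\mathbb{P}$ be the set of all prime numbers. For every $\mathcal{T}\subseteq\mathbb{N}\setminus\{0\}$ and every integer $k\ge0$, $$k!_{\mathbb{P},\mathcal{T}}=\prod_{\substack{b\in\mathcal{T}\\ \varphi(b)+\omega(b)\le k}} b^{\left\lfloor\frac{k-\omega(b)}{\varphi(b)}\right\rfloor+\left\lfloor\frac{k-\omega(b)}{b\varphi(b)}\right\rfloor+\left\lfloor\frac{k-\omega(b)}{b^2\varphi(b)}\right\rfloor+\cdots},$$ where $\varphi$ is Euler's totient function and $\omega(b)$ is the number of distinct prime divisors of $b$.
   Context: $\mathbb{N}=\{0,1,2,\dots\}$. For an integer $b\ge0$ and $a\in\mathbb{Z}$ define $\operatorname{ord}_b(a):=\sup\{k\in\mathbb{N}: a\mathbb{Z}\subseteq b^k\mathbb{Z}\}$ (convention $0^0=1$); thus for $b\ge2$ it is the largest $k$ with $b^k\mid a$ ($+\infty$ for $a=0$), and $\operatorname{ord}_1(a)=+\infty$ for all $a$. For nonempty $S\subseteq\mathbb{Z}$, a $b$-ordering of $S$ is a sequence $(a_i)_{i\ge0}$ in $S$ such that for each $i\ge1$, $a_i$ attains $\min_{a'\in S}\sum_{j=0}^{i-1}\operatorname{ord}_b(a'-a_j)$; the $b$-exponent sequence is $\alpha_k(S,b):=\sum_{j=0}^{k-1}\operatorname{ord}_b(a_k-a_j)$ for any $b$-ordering (independent of the choice). For $\mathcal{T}\subseteq\mathbb{N}$ the generalized factorial is $k!_{S,\mathcal{T}}:=\prod_{b\in\mathcal{T}}b^{\alpha_k(S,b)}$,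 with conventions $b^{+\infty}=0$ for $b=0$ and $b\ge2$, $1^{+\infty}=1$, and $b^0=1$ for all $b\in\mathbb{N}$. *)

theory Defs
  imports "HOL-Number_Theory.Number_Theory" "HOL-Library.Extended_Nat"
begin

definition ordb :: "nat \<Rightarrow> int \<Rightarrow> enat" where
  "ordb b a = Sup {enat k | k. (int b) ^ k dvd a}"

definition b_ordering :: "int set \<Rightarrow> nat \<Rightarrow> (nat \<Rightarrow> int) \<Rightarrow> bool" where
  "b_ordering S b a \<longleftrightarrow> (\<forall>i. a i \<in> S) \<and>
     (\<forall>i\<ge>1. \<forall>a'\<in>S. (\<Sum>j<i. ordb b (a i - a j)) \<le> (\<Sum>j<i. ordb b (a' - a j)))"

definition alpha :: "int set \<Rightarrow> nat \<Rightarrow> nat \<Rightarrow> enat" where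
  "alpha S b k = (let a = (SOME a. b_ordering S b a) in (\<Sum>j<k. ordb b (a k - a j)))"

definition epow :: "nat \<Rightarrow> enat \<Rightarrow> nat" where
  "epow b e = (case e of enat n \<Rightarrow> b ^ n | \<infinity> \<Rightarrow> (if b = 1 then 1 else 0))"

text \<open>Generalized factorial: product over b in T of the (only finitely many, in the
  relevant cases) nontrivial factors.\<close>
definition gen_fact :: "int set \<Rightarrow> nat set \<Rightarrow> nat \<Rightarrow> nat" where
  "gen_fact S T k = (\<Prod>b\<in>{b\<in>T. epow b (alpha S b k) \<noteq> 1}. epow b (alpha S b k))"

definition omega :: "nat \<Rightarrow> nat" where
  "omega b = card (prime_factors b)"

definition floor_series :: "nat \<Rightarrow> nat \<Rightarrow> enat" where
  "floor_series b m = (SUP n. enat (\<Sum>i<n. m div (b ^ i * totient b)))"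

end

(* For b >= 2 the valuation is ord_b(x) = #{i >= 1 : b^i | x}, so the cost of a candidate x against
   a_0, ..., a_{k-1} counts congruences x = a_j modulo all powers of b.  The primes meet every residue
   class coprime to b^i (Dirichlet), and each of the omega(b) primes dividing b is alone in its class
   modulo b.  Hence a candidate always exists whose cost is at most the claimed exponent: an unused
   prime divisor of b (cost 0), or a prime in a class chosen level by level by pigeonhole.
   Conversely, the first n costs of an ordering sum to the number of congruent pairs at all levels,
   and that number is minimal when the classes are filled evenly, which gives exactly the sum of the
   first n claimed exponents.  So all inequalities are equalities, without tracking the greedy choice.

   Dirichlet's theorem is proved along the lines of Mertens and Shapiro: for a nonprincipal character
   the sum of psi(n) Lambda(n) / n over n <= N is O(1) if L(1, psi) is nonzero and -ln N + O(1) otherwise.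
   Positivity of the sum over n = 1 (mod q) leaves room for at most one vanishing L(1, psi), which is
   then real, and a real one is excluded by Monsky's argument with Lambert series. *)

theory Submission
  imports Defs "HOL-Analysis.Complex_Transcendental" "HOL-Computational_Algebra.Squarefree"
begin

section \<open>Dirichlet characters\<close>

text \<open>A repeated term has infinite cost, so a prime in a well-chosen class helps only if it is
  new. Choosing the class modulo \<open>b ^ (k + 1)\<close> settles this: at that level the
  admissible number of coincidences is already 0, because \<open>k < b ^ k\<close>. So Dirichlet's
  theorem enters as the existence of one prime per class.

  The divisors \<open>b ^ i * totient b\<close> are the numbers of unit classes modulo
  \<open>b ^ (i + 1)\<close>, and \<open>k - omega b\<close> bounds the number of earlier terms
  lying in them once every prime divisor of \<open>b\<close> has been spent.

  The analysis stays at s = 1 with partial sums, and periodicity combined with Abel summation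
  supplies explicit error terms. In the sum over all characters the principal one contributes
  \<open>ln N\<close> and every vanishing L-value contributes \<open>- ln N\<close>. A nonreal zero
  brings its conjugate along, and 1 - 1 - 1 < 0 would make a nonnegative sum tend to minus infinity.
  A real character has no such partner, which is why it requires an argument of its own.\<close>

definition dirichlet_char :: "nat \<Rightarrow> (nat \<Rightarrow> complex) \<Rightarrow> bool" where
  "dirichlet_char q \<psi> \<longleftrightarrow> (\<forall>m n. \<psi> (m * n) = \<psi> m * \<psi> n) \<and>
     (\<forall>m n. [m = n] (mod q) \<longrightarrow> \<psi> m = \<psi> n) \<and> (\<forall>n. \<psi> n \<noteq> 0 \<longleftrightarrow> coprime n q)"

section \<open>Extending characters from subgroups of the units modulo \<open>q\<close>\<close>

definition partial_char :: "nat \<Rightarrow> nat set \<Rightarrow> (nat \<Rightarrow> complex) \<Rightarrow> bool" where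
  "partial_char q H \<psi> \<longleftrightarrow> 1 \<in> H \<and> (\<forall>m\<in>H. coprime m q) \<and>
     (\<forall>m\<in>H. \<forall>n\<in>H. m * n \<in> H \<and> \<psi> (m * n) = \<psi> m * \<psi> n) \<and>
     (\<forall>m\<in>H. \<forall>n. [m = n] (mod q) \<longrightarrow> n \<in> H \<and> \<psi> m = \<psi> n) \<and> \<psi> 1 = 1"

lemma partial_charD:
  assumes "partial_char q H \<psi>"
  shows "1 \<in> H" "m \<in> H \<Longrightarrow> coprime m q" "m \<in> H \<Longrightarrow> n \<in> H \<Longrightarrow> m * n \<in> H"
    "m \<in> H \<Longrightarrow> n \<in> H \<Longrightarrow> \<psi> (m * n) = \<psi> m * \<psi> n"
    "m \<in> H \<Longrightarrow> [m = k] (mod q) \<Longrightarrow> k \<in> H"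
    "m \<in> H \<Longrightarrow> [m = k] (mod q) \<Longrightarrow> \<psi> m = \<psi> k" "\<psi> 1 = 1"
  using assms unfolding partial_char_def by blast+

lemma partial_char_power:
  assumes "partial_char q H \<psi>" "m \<in> H"
  shows "m ^ i \<in> H \<and> \<psi> (m ^ i) = \<psi> m ^ i"
  using partial_charD[OF assms(1)] assms(2) by (induction i) auto

text \<open>By Euler's theorem the inverse of \<open>m\<close> is a power of \<open>m\<close>.
  Closure under products and congruence therefore makes \<open>H\<close> the preimage of a subgroup
  of the unit group.\<close>

lemma partial_char_inverse:
  assumes "partial_char q H \<psi>" "m \<in> H" "q > 0"
  shows "\<exists>m'\<in>H. [m * m' = 1] (mod q)"
proof (rule bexI)
  have "totient q > 0" using assms by simp
  then have "m * m ^ (totient q - 1) = m ^ totient q"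
    by (metis Suc_diff_1 power_Suc)
  then show "[m * m ^ (totient q - 1) = 1] (mod q)"
    using euler_theorem[of m q] partial_charD(2)[OF assms(1,2)] by simp
qed (use partial_char_power assms in blast)

text \<open>Adjoining one element: \<open>n\<close> is the order of \<open>x\<close> modulo
  \<open>H\<close>, and any \<open>n\<close>-th root \<open>z\<close> of the prescribed value at
  \<open>x ^ n\<close> gives an extension sending \<open>x ^ i * h\<close> to
  \<open>z ^ i * \<psi> h\<close>. The free choice of \<open>z\<close> is what later separates
  elements.\<close>

lemma partial_char_extend:
  assumes P: "partial_char q H \<psi>" and q: "q > 0" and x: "coprime x q" and n: "n > 0"
    and xn: "x ^ n \<in> H" and min: "\<And>i. 0 < i \<Longrightarrow> i < n \<Longrightarrow> x ^ i \<notin> H"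
    and z: "z ^ n = \<psi> (x ^ n)"
  shows "\<exists>H' \<psi>'. partial_char q H' \<psi>' \<and> H \<subseteq> H' \<and> x \<in> H' \<and> (\<forall>h\<in>H. \<psi>' h = \<psi> h) \<and> \<psi>' x = z"
proof -
  note D = partial_charD[OF P]
  \<comment> \<open>Minimality of \<open>n\<close> forces \<open>n\<close> to divide
    \<open>i\<close>: cancelling a power of \<open>x ^ n\<close> puts \<open>x ^ (i mod n)\<close>
    into \<open>H\<close>.\<close>
  have key1: "\<psi> (x ^ i) = z ^ i" if i: "x ^ i \<in> H" for i
  proof -
    define t where "t = i div n"
    have e: "i = n * t + i mod n" by (simp add: t_def)
    have tH: "(x ^ n) ^ t \<in> H" and tc: "\<psi> ((x ^ n) ^ t) = \<psi> (x ^ n) ^ t"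
      using partial_char_power[OF P xn] by auto
    obtain w where w: "w \<in> H" "[(x ^ n) ^ t * w = 1] (mod q)"
      using partial_char_inverse[OF P tH q] by blast
    have xi: "x ^ i = (x ^ n) ^ t * x ^ (i mod n)"
      by (metis e power_add power_mult)
    have "[x ^ i * w = x ^ (i mod n) * ((x ^ n) ^ t * w)] (mod q)"
      by (simp add: xi mult_ac)
    also have "[x ^ (i mod n) * ((x ^ n) ^ t * w) = x ^ (i mod n) * 1] (mod q)"
      by (intro cong_mult cong_refl w)
    finally have "x ^ (i mod n) \<in> H" using D(3)[OF i w(1)] D(5) by simp
    then have "i mod n = 0" using min[of "i mod n"] n by (cases "i mod n = 0") auto
    then have "i = n * t" using e by simp
    then show ?thesis using tc z by (simp add: power_mult)
  qed
  \<comment> \<open>Independence of the representation: cancelling \<open>x ^ i\<close> leaves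
    \<open>x ^ (j - i)\<close> in \<open>H\<close>, where \<open>key1\<close> applies.\<close>
  have key2: "z ^ i * \<psi> h = z ^ j * \<psi> h'"
    if c: "[x ^ i * h = x ^ j * h'] (mod q)" and h: "h \<in> H" "h' \<in> H" and ij: "i \<le> j" for i j h h'
  proof -
    have xj: "x ^ j = x ^ i * x ^ (j - i)" using ij by (simp flip: power_add)
    have "[x ^ i * h = x ^ i * (x ^ (j - i) * h')] (mod q)"
      using c by (simp add: xj mult_ac)
    then have c2: "[h = x ^ (j - i) * h'] (mod q)"
      using x by (subst (asm) cong_mult_lcancel_nat) auto
    obtain w where w: "w \<in> H" "[h' * w = 1] (mod q)"
      using partial_char_inverse[OF P h(2) q] by blast
    have "[h * w = x ^ (j - i) * h' * w] (mod q)" by (intro cong_mult cong_refl c2)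
    also have "x ^ (j - i) * h' * w = x ^ (j - i) * (h' * w)" by (simp add: mult_ac)
    also have "[x ^ (j - i) * (h' * w) = x ^ (j - i) * 1] (mod q)"
      by (intro cong_mult cong_refl w)
    finally have xH: "x ^ (j - i) \<in> H" using D(3)[OF h(1) w(1)] D(5) by simp
    have "\<psi> h = \<psi> (x ^ (j - i) * h')" using D(6)[OF h(1) c2] .
    also have "\<dots> = z ^ (j - i) * \<psi> h'" using D(4)[OF xH h(2)] key1[OF xH] by simp
    finally show ?thesis using ij by (simp flip: power_add mult.assoc)
  qed
  have key3: "z ^ i * \<psi> h = z ^ j * \<psi> h'"
    if "[x ^ i * h = x ^ j * h'] (mod q)" "h \<in> H" "h' \<in> H" for i j h h'
    using key2[of i h j h'] key2[of j h' i h] that by (metis cong_sym nat_le_linear)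
  define R where "R = (\<lambda>m v. \<exists>i h. h \<in> H \<and> [m = x ^ i * h] (mod q) \<and> v = z ^ i * \<psi> h)"
  define H' where "H' = {m. \<exists>v. R m v}"
  define \<psi>' where "\<psi>' = (\<lambda>m. THE v. R m v)"
  have uniq: "v = v'" if "R m v" "R m v'" for m v v'
    using that unfolding R_def by (metis key3 cong_sym cong_trans)
  have val: "\<psi>' m = v" if "R m v" for m v
    unfolding \<psi>'_def using that uniq by blast
  have Rmult: "R (m * m') (v * v')" if "R m v" "R m' v'" for m m' v v'
  proof -
    obtain i h j h' where *: "h \<in> H" "[m = x ^ i * h] (mod q)" "v = z ^ i * \<psi> h"
      "h' \<in> H" "[m' = x ^ j * h'] (mod q)" "v' = z ^ j * \<psi> h'"
      using \<open>R m v\<close> \<open>R m' v'\<close> unfolding R_def by blast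
    have "[m * m' = x ^ (i + j) * (h * h')] (mod q)"
      using cong_mult[OF *(2,5)] by (simp add: power_add mult_ac)
    moreover have "v * v' = z ^ (i + j) * \<psi> (h * h')"
      using D(4)[OF *(1,4)] * by (simp add: power_add)
    ultimately show ?thesis unfolding R_def using D(3)[OF *(1,4)] by blast
  qed
  have RH: "R h (\<psi> h)" if "h \<in> H" for h
    unfolding R_def using that by (intro exI[of _ 0] exI[of _ h]) auto
  have Rx: "R x z"
    unfolding R_def using D(1,7) by (intro exI[of _ 1] exI[of _ 1]) auto
  have "partial_char q H' \<psi>'"
    unfolding partial_char_def
  proof (intro conjI ballI allI impI)
    show "1 \<in> H'" "\<psi>' 1 = 1" using RH[OF D(1)] val[OF RH[OF D(1)]] D(7) by (auto simp: H'_def)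
  next
    fix m assume "m \<in> H'"
    then obtain i h where "h \<in> H" "[m = x ^ i * h] (mod q)" by (auto simp: H'_def R_def)
    moreover have "coprime (x ^ i * h) q" using D(2)[OF \<open>h \<in> H\<close>] x by simp
    ultimately show "coprime m q" using cong_imp_coprime cong_sym by blast
  next
    fix m n assume "m \<in> H'" "n \<in> H'"
    then obtain v w where "R m v" "R n w" by (auto simp: H'_def)
    from Rmult[OF this] val[OF this(1)] val[OF this(2)] val[OF Rmult[OF this]]
    show "m * n \<in> H'" "\<psi>' (m * n) = \<psi>' m * \<psi>' n" by (auto simp: H'_def)
  next
    fix m n assume "m \<in> H'" and c: "[m = n] (mod q)"
    then obtain v where v: "R m v" by (auto simp: H'_def)
    then have "R n v" unfolding R_def using cong_trans[OF cong_sym[OF c]] by blast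
    then show "n \<in> H'" "\<psi>' m = \<psi>' n" using val[OF v] val by (auto simp: H'_def)
  qed
  then show ?thesis
    using RH Rx val by (intro exI[of _ H'] exI[of _ \<psi>']) (auto simp: H'_def)
qed

lemma exists_minimal_power:
  assumes "partial_char q H \<psi>" "q > 0" "coprime x q"
  shows "\<exists>n>0. x ^ n \<in> H \<and> (\<forall>i. 0 < i \<longrightarrow> i < n \<longrightarrow> x ^ i \<notin> H)"
proof -
  define P where "P = (\<lambda>n. n > 0 \<and> x ^ n \<in> H)"
  have "[1 = x ^ totient q] (mod q)" using euler_theorem[OF assms(3)] by (rule cong_sym)
  then have "x ^ totient q \<in> H" using partial_charD[OF assms(1)] by blast
  then have "P (totient q)" using assms by (simp add: P_def)
  then have "P (LEAST n. P n)" by (rule LeastI)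
  then show ?thesis using not_less_Least[of _ P] by (intro exI[of _ "LEAST n. P n"]) (auto simp: P_def)
qed

text \<open>Start from the trivial subgroup, adjoin \<open>a\<close> with a value other than 1, and
  extend as far as possible; a maximal domain contains every unit, since any missing unit could be
  adjoined.\<close>

lemma exists_separating_char:
  assumes q: "q > 0" and a: "coprime a q" "\<not> [a = 1] (mod q)"
  shows "\<exists>\<psi>. dirichlet_char q \<psi> \<and> \<psi> a \<noteq> 1"
proof -
  define P where "P = (\<lambda>(H, \<psi>). partial_char q H \<psi> \<and> a \<in> H \<and> \<psi> a \<noteq> 1)"
  define H0 where "H0 = {m. [m = 1] (mod q)}"
  have "coprime m q" if "[m = 1] (mod q)" for m
    using cong_imp_coprime[OF cong_sym[OF that]] by simp
  then have P0: "partial_char q H0 (\<lambda>_. 1)"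
    unfolding partial_char_def H0_def
    using cong_mult[of _ 1 q _ 1] by (auto intro: cong_trans cong_sym)
  obtain n where n: "n > 0" "a ^ n \<in> H0" "\<And>i. 0 < i \<Longrightarrow> i < n \<Longrightarrow> a ^ i \<notin> H0"
    using exists_minimal_power[OF P0 q a(1)] by blast
  have "n \<noteq> 1" using n(2) a(2) unfolding H0_def by (metis mem_Collect_eq power_one_right)
  then have n2: "n > 1" using n(1) by simp
  \<comment> \<open>A primitive \<open>n\<close>-th root of unity. It differs from 1 because the
    order \<open>n\<close> of \<open>a\<close> exceeds 1.\<close>
  define z where "z = cis (2 * pi / n)"
  have "z ^ n = 1" unfolding z_def using n(1) by (simp add: Complex.DeMoivre)
  moreover have "z \<noteq> 1"
  proof
    assume "z = 1"
    then have "cis (2 * pi * real 1 / real n) = cis (2 * pi * real 0 / real n)" by (simp add: z_def)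
    then show False
      using Complex.bij_betw_roots_unity[OF n(1)] n2 unfolding bij_betw_def inj_on_def
      by (metis lessThan_iff less_trans zero_less_one zero_neq_one)
  qed
  ultimately obtain p1 where p1: "P p1"
    using partial_char_extend[OF P0 q a(1) n, of z] unfolding P_def by auto
  \<comment> \<open>The domains are infinite sets of naturals, so their size is measured by the
    residues below \<open>q\<close>; this bounded measure replaces Zorn's lemma.\<close>
  have "card (H \<inter> {..<q}) \<le> q" for H
    using card_mono[of "{..<q}" "H \<inter> {..<q}"] by simp
  then have bd: "\<forall>p. P p \<longrightarrow> card (fst p \<inter> {..<q}) < Suc q" by (simp add: less_Suc_eq_le)
  obtain p where p: "P p" "\<forall>p'. P p' \<longrightarrow> card (fst p' \<inter> {..<q}) \<le> card (fst p \<inter> {..<q})"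
    using ex_has_greatest_nat[of P p1 "\<lambda>p. card (fst p \<inter> {..<q})", OF p1 bd] by blast
  obtain H \<psi> where "p = (H, \<psi>)" by fastforce
  then have H: "P (H, \<psi>)"
    and max: "\<And>H' \<psi>'. P (H', \<psi>') \<Longrightarrow> card (H' \<inter> {..<q}) \<le> card (H \<inter> {..<q})"
    using p by fastforce+
  then have pc: "partial_char q H \<psi>" and aH: "a \<in> H" "\<psi> a \<noteq> 1" by (auto simp: P_def)
  note D = partial_charD[OF pc]
  have full: "x \<in> H" if x: "coprime x q" for x
  proof (rule ccontr)
    assume xH: "x \<notin> H"
    obtain n where n: "n > 0" "x ^ n \<in> H" "\<And>i. 0 < i \<Longrightarrow> i < n \<Longrightarrow> x ^ i \<notin> H"
      using exists_minimal_power[OF pc q x] by blast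
    obtain z where "z ^ n = \<psi> (x ^ n)" using exists_complex_root[of n "\<psi> (x ^ n)"] n by metis
    from partial_char_extend[OF pc q x n this] obtain H' \<psi>' where
      H': "partial_char q H' \<psi>'" "H \<subseteq> H'" "x \<in> H'" "\<forall>h\<in>H. \<psi>' h = \<psi> h" by blast
    then have "P (H', \<psi>')" using aH by (auto simp: P_def)
    \<comment> \<open>Closure under congruence replaces \<open>x\<close> by \<open>x mod q\<close>,
      so the growth of the domain is visible below \<open>q\<close>.\<close>
    moreover have "H \<inter> {..<q} \<subset> H' \<inter> {..<q}"
    proof -
      have "x mod q \<in> H'" using partial_charD(5)[OF H'(1,3)] by (simp add: cong_def)
      moreover have "x mod q \<notin> H" using xH D(5)[of "x mod q" x] by (auto simp: cong_def)
      ultimately show ?thesis using H'(2) q by auto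
    qed
    then have "card (H \<inter> {..<q}) < card (H' \<inter> {..<q})" by (intro psubset_card_mono) auto
    ultimately show False using max by fastforce
  qed
  have cc: "coprime m q \<longleftrightarrow> coprime n q" if "[m = n] (mod q)" for m n
    using that cong_imp_coprime cong_sym by blast
  have nz: "\<psi> m \<noteq> 0" if m: "m \<in> H" for m
  proof -
    obtain w where w: "w \<in> H" "[m * w = 1] (mod q)"
      using partial_char_inverse[OF pc m q] by blast
    then have "\<psi> (m * w) = 1" using D(3,6,7) m by metis
    then show ?thesis using D(4)[OF m w(1)] by auto
  qed
  have "dirichlet_char q (\<lambda>m. if coprime m q then \<psi> m else 0)"
    unfolding dirichlet_char_def
  proof (intro conjI allI impI)
    fix m n
    show "(if coprime (m * n) q then \<psi> (m * n) else 0) =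
        (if coprime m q then \<psi> m else 0) * (if coprime n q then \<psi> n else 0)"
      using D(4)[OF full full, of m n] by simp
    show "(if coprime m q then \<psi> m else 0) = (if coprime n q then \<psi> n else 0)"
      if "[m = n] (mod q)"
      using D(6)[OF full that] cc[OF that] by simp
    show "(if coprime n q then \<psi> n else 0) \<noteq> 0 \<longleftrightarrow> coprime n q"
      using nz[OF full, of n] by simp
  qed
  then show ?thesis using aH a(1) by (intro exI[of _ "\<lambda>m. if coprime m q then \<psi> m else 0"]) simp
qed

section \<open>Values, finiteness and orthogonality of characters\<close>

lemma dirichlet_charD:
  assumes "dirichlet_char q \<psi>"
  shows "\<psi> (m * n) = \<psi> m * \<psi> n" "[m = n] (mod q) \<Longrightarrow> \<psi> m = \<psi> n" "\<psi> n = 0 \<longleftrightarrow> \<not> coprime n q"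
    "\<psi> (Suc 0) = 1" "\<psi> 1 = 1" "\<psi> (n ^ k) = \<psi> n ^ k"
proof -
  show *: "\<psi> (m * n) = \<psi> m * \<psi> n" for m n
    using assms unfolding dirichlet_char_def by blast
  show "[m = n] (mod q) \<Longrightarrow> \<psi> m = \<psi> n" "\<psi> n = 0 \<longleftrightarrow> \<not> coprime n q"
    using assms unfolding dirichlet_char_def by blast+
  have "\<psi> 1 \<noteq> 0" using assms unfolding dirichlet_char_def by simp
  then show **: "\<psi> 1 = 1" using *[of 1 1] by simp
  then show "\<psi> (Suc 0) = 1" by simp
  show "\<psi> (n ^ k) = \<psi> n ^ k" by (induction k) (use * ** in auto)
qed

lemma dirichlet_char_root_of_unity:
  assumes "dirichlet_char q \<psi>" "coprime n q"
  shows "\<psi> n ^ totient q = 1"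
  using dirichlet_charD(2)[OF assms(1) euler_theorem[OF assms(2)]]
  by (simp add: dirichlet_charD(4-6)[OF assms(1)])

lemma norm_dirichlet_char:
  assumes "dirichlet_char q \<psi>" "q > 0"
  shows "norm (\<psi> n) = (if coprime n q then 1 else 0)"
proof (cases "coprime n q")
  case True
  have "norm (\<psi> n) ^ totient q = 1"
    using dirichlet_char_root_of_unity[OF assms(1) True] by (metis norm_one norm_power)
  then have "norm (\<psi> n) = 1"
    using power_eq_imp_eq_base[of "norm (\<psi> n)" "totient q" 1] assms(2) by simp
  then show ?thesis using True by simp
qed (use dirichlet_charD(3)[OF assms(1)] in simp)

lemma norm_dirichlet_char_le:
  "dirichlet_char q \<psi> \<Longrightarrow> q > 0 \<Longrightarrow> norm (\<psi> n) \<le> 1"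
  by (simp add: norm_dirichlet_char)

definition principal_char :: "nat \<Rightarrow> nat \<Rightarrow> complex" where
  "principal_char q n = (if coprime n q then 1 else 0)"

lemma cong_imp_coprime_iff: "[m = n] (mod q) \<Longrightarrow> coprime m q \<longleftrightarrow> coprime n (q :: nat)"
  by (metis cong_imp_coprime cong_sym)

lemma dirichlet_char_principal: "dirichlet_char q (principal_char q)"
  unfolding dirichlet_char_def
proof (intro conjI allI impI)
  show "principal_char q m = principal_char q n" if "[m = n] (mod q)" for m n
    unfolding principal_char_def cong_imp_coprime_iff[OF that] ..
qed (auto simp: principal_char_def)

lemma dirichlet_char_mult:
  assumes "dirichlet_char q \<psi>" "dirichlet_char q \<psi>'"
  shows "dirichlet_char q (\<lambda>n. \<psi> n * \<psi>' n)"
  unfolding dirichlet_char_def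
proof (intro conjI allI impI)
  fix m n
  show "\<psi> (m * n) * \<psi>' (m * n) = \<psi> m * \<psi>' m * (\<psi> n * \<psi>' n)"
    by (simp add: dirichlet_charD(1)[OF assms(1)] dirichlet_charD(1)[OF assms(2)] mult_ac)
  show "\<psi> m * \<psi>' m = \<psi> n * \<psi>' n" if "[m = n] (mod q)"
    using dirichlet_charD(2)[OF assms(1) that] dirichlet_charD(2)[OF assms(2) that] by simp
  show "\<psi> n * \<psi>' n \<noteq> 0 \<longleftrightarrow> coprime n q"
    by (simp add: dirichlet_charD(3)[OF assms(1)] dirichlet_charD(3)[OF assms(2)])
qed

lemma dirichlet_char_cnj:
  assumes "dirichlet_char q \<psi>"
  shows "dirichlet_char q (\<lambda>n. cnj (\<psi> n))"
  using assms unfolding dirichlet_char_def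
  by (metis complex_cnj_mult complex_cnj_zero_iff)

lemma dirichlet_char_cnj_mult:
  assumes "dirichlet_char q \<psi>" "q > 0"
  shows "cnj (\<psi> n) * \<psi> n = principal_char q n"
  using norm_dirichlet_char[OF assms, of n]
  by (auto simp: principal_char_def complex_norm_square[symmetric] mult.commute)

text \<open>A character is determined by its values on one period, each of which is 0 or a root of
  unity of order dividing \<open>totient q\<close>.\<close>

lemma finite_dirichlet_char:
  assumes "q > 0"
  shows "finite {\<psi>. dirichlet_char q \<psi>}"
proof (rule finite_imageD)
  let ?R = "{z :: complex. z ^ totient q = 1}"
  have "(\<lambda>\<psi>. restrict \<psi> {..<q}) ` {\<psi>. dirichlet_char q \<psi>} \<subseteq> PiE {..<q} (\<lambda>_. insert 0 ?R)"
    by (auto simp: dirichlet_char_root_of_unity dirichlet_charD(3) split: if_splits)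
  moreover have "finite ?R" by (rule finite_roots_unity) (use assms in \<open>simp add: Suc_le_eq\<close>)
  ultimately show "finite ((\<lambda>\<psi>. restrict \<psi> {..<q}) ` {\<psi>. dirichlet_char q \<psi>})"
    by (meson finite_PiE finite_insert finite_lessThan finite_subset)
  show "inj_on (\<lambda>\<psi>. restrict \<psi> {..<q}) {\<psi>. dirichlet_char q \<psi>}"
  proof (intro inj_onI ext)
    fix \<psi> \<psi>' n
    assume *: "\<psi> \<in> {\<psi>. dirichlet_char q \<psi>}" "\<psi>' \<in> {\<psi>. dirichlet_char q \<psi>}"
      and eq: "restrict \<psi> {..<q} = restrict \<psi>' {..<q}"
    have "\<psi> (n mod q) = \<psi>' (n mod q)" using fun_cong[OF eq, of "n mod q"] assms by simp
    moreover have "\<psi> (n mod q) = \<psi> n" "\<psi>' (n mod q) = \<psi>' n"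
      using * by (auto intro!: dirichlet_charD(2)[of q] simp: cong_def)
    ultimately show "\<psi> n = \<psi>' n" by simp
  qed
qed

text \<open>Multiplication by a character separating \<open>a\<close> from 1 permutes all
  characters, with multiplication by its conjugate as inverse, so the sum is fixed under a factor
  other than 1. The number of characters stays a cardinality; later only its sign matters.\<close>

lemma sum_dirichlet_chars:
  assumes q: "q > 0" and a: "coprime a q"
  shows "(\<Sum>\<psi> | dirichlet_char q \<psi>. \<psi> a) =
    (if [a = 1] (mod q) then of_nat (card {\<psi>. dirichlet_char q \<psi>}) else 0)"
proof (cases "[a = 1] (mod q)")
  case True
  then have "\<psi> a = 1" if "dirichlet_char q \<psi>" for \<psi>
    using dirichlet_charD(2)[OF that True] dirichlet_charD(5)[OF that] by simp
  then have "(\<Sum>\<psi> | dirichlet_char q \<psi>. \<psi> a) = (\<Sum>\<psi> | dirichlet_char q \<psi>. 1)"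
    by (intro sum.cong) auto
  then show ?thesis using True by simp
next
  case False
  obtain \<psi>' where c: "dirichlet_char q \<psi>'" "\<psi>' a \<noteq> 1"
    using exists_separating_char[OF q a False] by blast
  have "(\<Sum>\<psi> | dirichlet_char q \<psi>. \<psi> a) = (\<Sum>\<psi> | dirichlet_char q \<psi>. \<psi>' a * \<psi> a)"
  proof (rule sum.reindex_bij_witness[of _ "\<lambda>\<psi> n. \<psi>' n * \<psi> n" "\<lambda>\<psi> n. cnj (\<psi>' n) * \<psi> n"], goal_cases)
    case (1 \<psi>)
    then show ?case
      using dirichlet_char_cnj_mult[OF c(1) q] dirichlet_charD(3)[of q \<psi>]
      by (auto simp: principal_char_def fun_eq_iff mult.assoc[symmetric] mult.commute[of "\<psi>' _"])
  next
    case (3 \<psi>)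
    then show ?case
      using dirichlet_char_cnj_mult[OF c(1) q] dirichlet_charD(3)[of q \<psi>]
      by (auto simp: principal_char_def fun_eq_iff mult.assoc[symmetric])
  next
    case (5 \<psi>)
    then show ?case
      using dirichlet_char_cnj_mult[OF c(1) q, of a] a
      by (auto simp: principal_char_def mult.assoc[symmetric] mult.commute[of "\<psi>' _"])
  qed (use c dirichlet_char_mult dirichlet_char_cnj in auto)
  also have "\<dots> = \<psi>' a * (\<Sum>\<psi> | dirichlet_char q \<psi>. \<psi> a)" by (simp add: sum_distrib_left)
  finally show ?thesis using c False by simp
qed

text \<open>Multiplication by a unit \<open>c\<close> with \<open>\<psi> c \<noteq> 1\<close>
  permutes the residues and multiplies the sum by \<open>\<psi> c\<close>.\<close>

lemma sum_dirichlet_char_period: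
  assumes \<psi>: "dirichlet_char q \<psi>" and q: "q > 0" and np: "\<psi> \<noteq> principal_char q"
  shows "(\<Sum>n<q. \<psi> n) = 0"
proof -
  obtain c where "\<psi> c \<noteq> principal_char q c" using np by blast
  then have c: "coprime c q" "\<psi> c \<noteq> 1"
    using dirichlet_charD(3)[OF \<psi>, of c] by (auto simp: principal_char_def split: if_splits)
  have inj: "inj_on (\<lambda>n. c * n mod q) {..<q}"
  proof (rule inj_onI)
    fix m n assume "m \<in> {..<q}" "n \<in> {..<q}" "c * m mod q = c * n mod q"
    then have "[m = n] (mod q)" using cong_mult_lcancel_nat[OF c(1)] by (simp add: cong_def)
    then show "m = n" using \<open>m \<in> {..<q}\<close> \<open>n \<in> {..<q}\<close> by (simp add: cong_less_modulus_unique_nat)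
  qed
  then have "(\<lambda>n. c * n mod q) ` {..<q} = {..<q}"
    using q by (intro endo_inj_surj) auto
  then have "bij_betw (\<lambda>n. c * n mod q) {..<q} {..<q}" using inj by (simp add: bij_betw_def)
  then have "(\<Sum>n<q. \<psi> n) = (\<Sum>n<q. \<psi> (c * n mod q))"
    by (rule sum.reindex_bij_betw[symmetric])
  also have "\<dots> = (\<Sum>n<q. \<psi> c * \<psi> n)"
  proof (rule sum.cong[OF refl])
    fix n
    have "[c * n mod q = c * n] (mod q)" by (simp add: cong_def)
    then show "\<psi> (c * n mod q) = \<psi> c * \<psi> n" using dirichlet_charD(1,2)[OF \<psi>] by metis
  qed
  also have "\<dots> = \<psi> c * (\<Sum>n<q. \<psi> n)" by (simp add: sum_distrib_left)
  finally show ?thesis using c by simp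
qed

text \<open>Full periods cancel, which leaves fewer than \<open>q\<close> terms of norm at most
  1.\<close>

lemma norm_sum_dirichlet_char_le:
  assumes \<psi>: "dirichlet_char q \<psi>" and q: "q > 0" and np: "\<psi> \<noteq> principal_char q"
  shows "norm (\<Sum>n<N. \<psi> n) \<le> q"
proof (induction N rule: less_induct)
  case (less N)
  show ?case
  proof (cases "N < q")
    case True
    have "norm (\<Sum>n<N. \<psi> n) \<le> (\<Sum>n<N. 1)"
      by (rule sum_norm_le) (rule norm_dirichlet_char_le[OF \<psi> q])
    then show ?thesis using True by simp
  next
    case False
    then obtain M where M: "N = q + M" using le_Suc_ex not_less by blast
    have "(\<Sum>n<q + M. \<psi> n) = (\<Sum>n<q. \<psi> n) + (\<Sum>n<M. \<psi> (q + n))" for M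
      by (induction M) (auto simp: add.assoc)
    moreover have "\<psi> (q + n) = \<psi> n" for n
      by (rule dirichlet_charD(2)[OF \<psi>]) (simp add: cong_def)
    ultimately have "(\<Sum>n<N. \<psi> n) = (\<Sum>n<M. \<psi> n)"
      using sum_dirichlet_char_period[OF \<psi> q np] M by simp
    then show ?thesis using less.IH[of M] q M by simp
  qed
qed

lemma norm_sum_dirichlet_char_interval_le:
  assumes "dirichlet_char q \<psi>" and "q > 0" and "\<psi> \<noteq> principal_char q"
  shows "norm (\<Sum>n\<in>{M..<N}. \<psi> n) \<le> 2 * q"
proof (cases "M \<le> N")
  case True
  then have "(\<Sum>n\<in>{M..<N}. \<psi> n) = (\<Sum>n<N. \<psi> n) - (\<Sum>n<M. \<psi> n)"
    by (metis sum_diff_nat_ivl atLeast0LessThan le0)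
  also have "norm \<dots> \<le> real q + real q"
    by (intro order_trans[OF norm_triangle_ineq4] add_mono norm_sum_dirichlet_char_le assms)
  finally show ?thesis by simp
qed simp

section \<open>Mertens-type estimates\<close>

text \<open>Summation by parts: the differences of the weights are nonnegative and telescope, so the
  bound on the partial sums is multiplied by the first weight only.\<close>

lemma norm_sum_mult_decreasing_le:
  fixes f :: "nat \<Rightarrow> complex" and w :: "nat \<Rightarrow> real"
  assumes bound: "\<And>N. norm (\<Sum>n\<in>{M..<N}. f n) \<le> B"
    and dec: "\<And>n. n \<ge> M \<Longrightarrow> w (Suc n) \<le> w n" and nonneg: "\<And>n. n \<ge> M \<Longrightarrow> 0 \<le> w n"
  shows "norm (\<Sum>n\<in>{M..<N}. f n * w n) \<le> B * w M"
proof -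
  have B: "B \<ge> 0" using bound[of M] by simp
  define F where "F = (\<lambda>N. \<Sum>n\<in>{M..<N}. f n)"
  have parts: "(\<Sum>n\<in>{M..<N}. f n * w n) =
      F N * w N + (\<Sum>n\<in>{M..<N}. F (Suc n) * (w n - w (Suc n)))" if "M \<le> N" for N
    using that
  proof (induction N rule: dec_induct)
    case (step N)
    then have "F (Suc N) = F N + f N" by (simp add: F_def)
    then show ?case using step by (simp add: algebra_simps)
  qed (simp add: F_def)
  have tel: "(\<Sum>n\<in>{M..<N}. B * (w n - w (Suc n))) = B * (w M - w N)" if "M \<le> N" for N
    using that by (induction N rule: dec_induct) (auto simp: algebra_simps)
  show ?thesis
  proof (cases "M \<le> N")
    case True
    have "norm (F (Suc n) * (w n - w (Suc n))) \<le> B * (w n - w (Suc n))" if "n \<in> {M..<N}" for n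
    proof -
      have "norm (complex_of_real (w n) - complex_of_real (w (Suc n))) = w n - w (Suc n)"
        using dec[of n] that by (metis abs_of_nonneg atLeastLessThan_iff diff_ge_0_iff_ge norm_of_real of_real_diff)
      then show ?thesis using bound[of "Suc n"] dec[of n] that
        by (simp add: norm_mult F_def mult_right_mono)
    qed
    then have "norm (\<Sum>n\<in>{M..<N}. F (Suc n) * (w n - w (Suc n))) \<le> (\<Sum>n\<in>{M..<N}. B * (w n - w (Suc n)))"
      by (rule sum_norm_le)
    then have "norm (\<Sum>n\<in>{M..<N}. F (Suc n) * (w n - w (Suc n))) \<le> B * (w M - w N)"
      by (simp only: tel[OF True])
    moreover have "norm (F N * w N) \<le> B * w N"
      using bound[of N] nonneg[OF True] by (simp add: norm_mult F_def mult_right_mono)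
    ultimately have "norm (F N * w N + (\<Sum>n\<in>{M..<N}. F (Suc n) * (w n - w (Suc n)))) \<le> B * w N + B * (w M - w N)"
      by (intro order_trans[OF norm_triangle_ineq] add_mono) auto
    then show ?thesis using parts[OF True] by (simp add: algebra_simps)
  qed (use B nonneg[of M] in simp)
qed

text \<open>Both sides run over the pairs \<open>(d, m)\<close> of positive numbers with
  \<open>d * m \<le> N\<close>. This turns summed Dirichlet convolutions into combinations of
  partial sums up to \<open>N div d\<close>.\<close>

lemma sum_divisors_swap:
  fixes g :: "nat \<Rightarrow> nat \<Rightarrow> 'a :: comm_monoid_add"
  shows "(\<Sum>n\<in>{1..N}. \<Sum>d | d dvd n. g d (n div d)) = (\<Sum>d\<in>{1..N}. \<Sum>m\<in>{1..N div d}. g d m)"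
proof -
  have "(\<Sum>n\<in>{1..N}. \<Sum>d | d dvd n. g d (n div d)) =
      (\<Sum>(n, d)\<in>(SIGMA n:{1..N}. {d. d dvd n}). g d (n div d))"
    by (rule sum.Sigma) auto
  also have "\<dots> = (\<Sum>(d, m)\<in>(SIGMA d:{1..N}. {1..N div d}). g d m)"
  proof (rule sum.reindex_bij_witness[of _ "\<lambda>(d, m). (d * m, d)" "\<lambda>(n, d). (d, n div d)"], goal_cases)
    case (2 x)
    then obtain n d where x: "x = (n, d)" "1 \<le> n" "n \<le> N" "d dvd n" by auto
    then obtain m where "n = d * m" by blast
    with x have "d > 0" "m > 0" by auto
    with x \<open>n = d * m\<close> show ?case
      by (auto simp: Suc_le_eq less_eq_div_iff_mult_less_eq mult.commute intro: le_trans[of d "d * m"])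
  next
    case (4 x)
    then obtain d m where x: "x = (d, m)" "1 \<le> d" "1 \<le> m" "m \<le> N div d" by auto
    then have "d * m \<le> N" by (simp add: less_eq_div_iff_mult_less_eq mult.commute)
    with x show ?case by auto
  qed auto
  also have "\<dots> = (\<Sum>d\<in>{1..N}. \<Sum>m\<in>{1..N div d}. g d m)"
    by (rule sum.Sigma[symmetric]) auto
  finally show ?thesis .
qed

section \<open>Chebyshev and Mertens bounds for the von Mangoldt function\<close>

lemma divide_le_div_add_one: "real N / real n \<le> real (N div n) + 1"
  using real_of_int_floor_add_one_ge[of "real N / real n"] by (simp add: floor_divide_of_nat_eq)

lemma ln_fact_eq_sum: "ln (fact N) = (\<Sum>n\<in>{1..N}. ln (real n))"
  by (induction N) (simp_all add: ln_mult)

lemma ln_fact_eq_sum_mangoldt: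
  "ln (fact N) = (\<Sum>d\<in>{1..N}. mangoldt d * real (N div d))"
proof -
  have "ln (fact N) = (\<Sum>n\<in>{1..N}. \<Sum>d | d dvd n. mangoldt d :: real)"
    unfolding ln_fact_eq_sum by (rule sum.cong) (use mangoldt_sum[where 'a = real] in auto)
  then show ?thesis
    using sum_divisors_swap[of "\<lambda>d m. mangoldt d :: real" N] by (simp add: mult.commute)
qed

text \<open>The weak form of Stirling's formula; the induction step is
  \<open>ln (1 + 1 / N) \<le> 1 / N\<close> multiplied by \<open>N\<close>.\<close>

lemma ln_fact_ge: "ln (fact N) \<ge> real N * ln (real N) - real N"
proof (induction N)
  case (Suc N)
  have "real N * ln (real (Suc N)) \<le> real N * ln (real N) + 1"
  proof (cases "N = 0")
    case False
    have "ln (real (Suc N) / real N) \<le> real (Suc N) / real N - 1"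
      using False by (intro ln_le_minus_one) auto
    also have "\<dots> = 1 / real N" using False by (simp add: field_simps)
    finally show ?thesis using False by (simp add: ln_div field_simps)
  qed simp
  moreover have "ln (fact (Suc N)) = ln (real (Suc N)) + ln (fact N)"
    by (subst fact_Suc) (simp add: ln_mult del: of_nat_Suc)
  moreover have "real (Suc N) * ln (real (Suc N)) = real N * ln (real (Suc N)) + ln (real (Suc N))"
    by (simp add: algebra_simps)
  moreover have "real (Suc N) = real N + 1" by simp
  ultimately show ?case using Suc by linarith
qed simp

lemma ln_fact_le: "ln (fact N) \<le> real N * ln (real N)"
proof -
  have "(\<Sum>n\<in>{1..N}. ln (real n)) \<le> (\<Sum>n\<in>{1..N}. ln (real N))" by (intro sum_mono) auto
  then show ?thesis by (simp add: ln_fact_eq_sum)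
qed

text \<open>Chebyshev's argument: the logarithm of the central binomial coefficient weights
  \<open>mangoldt d\<close> by \<open>2 * n div d - 2 * (n div d)\<close>, which is never negative
  and equals 1 for \<open>n < d \<le> 2 * n\<close>.\<close>

lemma sum_mangoldt_le: "(\<Sum>d\<in>{1..N}. mangoldt d) \<le> 4 * real N"
proof (induction N rule: less_induct)
  case (less N)
  define P where "P = (\<lambda>N. \<Sum>d\<in>{1..N}. mangoldt d :: real)"
  have double: "P (2 * n) \<le> P n + 2 * real n" for n
  proof -
    have split: "{1..2 * n} = {1..n} \<union> {n<..2 * n}" by auto
    have "ln (fact n) = (\<Sum>d\<in>{1..2 * n}. mangoldt d * real (n div d))"
      unfolding ln_fact_eq_sum_mangoldt split by (subst sum.union_disjoint) auto
    then have "ln (fact (2 * n)) - 2 * ln (fact n) =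
        (\<Sum>d\<in>{1..2 * n}. mangoldt d * (real (2 * n div d) - 2 * real (n div d)))"
      unfolding ln_fact_eq_sum_mangoldt[of "2 * n"]
      by (simp add: sum_distrib_left sum_subtractf right_diff_distrib mult_ac)
    moreover have "P (2 * n) - P n = (\<Sum>d\<in>{n<..2 * n}. mangoldt d)"
      unfolding P_def split by (subst sum.union_disjoint) auto
    moreover have "(\<Sum>d\<in>{n<..2 * n}. mangoldt d :: real) =
        (\<Sum>d\<in>{n<..2 * n}. mangoldt d * (real (2 * n div d) - 2 * real (n div d)))"
    proof (rule sum.cong[OF refl])
      fix d assume d: "d \<in> {n<..2 * n}"
      then have "2 * n div d = 1" "n div d = 0" by (auto intro: div_nat_eqI)
      then show "(mangoldt d :: real) = mangoldt d * (real (2 * n div d) - 2 * real (n div d))" by simp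
    qed
    moreover have "\<dots> \<le> (\<Sum>d\<in>{1..2 * n}. mangoldt d * (real (2 * n div d) - 2 * real (n div d)))"
    proof (rule sum_mono2)
      fix d assume "d \<in> {1..2 * n} - {n<..2 * n}"
      then have "2 * (n div d) \<le> 2 * n div d" by (simp add: less_eq_div_iff_mult_less_eq)
      then have "2 * real (n div d) \<le> real (2 * n div d)" by linarith
      then show "0 \<le> mangoldt d * (real (2 * n div d) - 2 * real (n div d))"
        by (simp add: mangoldt_nonneg)
    qed auto
    moreover have "ln (fact (2 * n)) - 2 * ln (fact n) \<le> 2 * real n"
    proof -
      have "real (2 * n choose n) \<le> real (2 ^ (2 * n))"
        using binomial_le_pow2[of "2 * n" n] by (simp only: of_nat_le_iff)
      moreover have "real (2 * n choose n) > 0" by simp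
      ultimately have "ln (real (2 * n choose n)) \<le> ln (real (2 ^ (2 * n)))" by (subst ln_le_cancel_iff) auto
      also have "\<dots> = 2 * real n * ln 2" by (simp add: ln_realpow)
      also have "\<dots> \<le> 2 * real n * 1" using ln_2_less_1 by (intro mult_left_mono) auto
      finally have "ln (real (2 * n choose n)) \<le> 2 * real n" by simp
      moreover have "real (2 * n choose n) = fact (2 * n) / (fact n * fact n)"
        by (simp add: binomial_fact)
      ultimately show ?thesis by (simp add: ln_div ln_mult)
    qed
    ultimately show ?thesis by linarith
  qed
  \<comment> \<open>Odd \<open>N\<close> is rounded up to \<open>2 * (n + 1)\<close>. The constant 4
    absorbs this: \<open>6 * (n + 1) \<le> 4 * (2 * n + 1)\<close> for
    \<open>n \<ge> 1\<close>.\<close>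
  have "N = 0 \<or> N = 1 \<or> (\<exists>n>0. N = 2 * n) \<or> (\<exists>n>0. N = 2 * n + 1)" by presburger
  then consider "N = 0" | "N = 1" | n where "N = 2 * n" "n > 0" | n where "N = 2 * n + 1" "n > 0"
    by blast
  then show ?case
  proof cases
    case (3 n)
    then have "P n \<le> 4 * real n" using less[of n] by (simp add: P_def)
    then show ?thesis using double[of n] 3 by (simp add: P_def)
  next
    case (4 n)
    then have "P (n + 1) \<le> 4 * real (n + 1)" using less[of "n + 1"] by (simp add: P_def)
    moreover have "P (2 * n + 1) \<le> P (2 * (n + 1))"
      unfolding P_def by (rule sum_mono2) (auto simp: mangoldt_nonneg)
    ultimately show ?thesis using double[of "n + 1"] 4 by (simp add: P_def)
  qed auto
qed

text \<open>Divide the expansion of \<open>ln (fact N)\<close> by \<open>N\<close>. Replacing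
  \<open>N div n\<close> by \<open>N / n\<close> costs at most the Chebyshev sum, hence the constant
  4.\<close>

lemma sum_mangoldt_over_le:
  assumes "N > 0"
  shows "(\<Sum>n\<in>{1..N}. mangoldt n / real n) \<le> ln (real N) + 4"
proof -
  have "real N * (\<Sum>n\<in>{1..N}. mangoldt n / real n) = (\<Sum>n\<in>{1..N}. mangoldt n * (real N / real n))"
    by (simp add: sum_distrib_left mult_ac)
  also have "\<dots> \<le> (\<Sum>n\<in>{1..N}. mangoldt n * (real (N div n) + 1))"
    by (intro sum_mono mult_left_mono mangoldt_nonneg divide_le_div_add_one)
  also have "\<dots> = ln (fact N) + (\<Sum>n\<in>{1..N}. mangoldt n)"
    by (simp add: ln_fact_eq_sum_mangoldt sum.distrib ring_distribs)
  also have "\<dots> \<le> real N * ln (real N) + 4 * real N"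
    by (intro add_mono ln_fact_le sum_mangoldt_le)
  finally have "real N * (\<Sum>n\<in>{1..N}. mangoldt n / real n) \<le> real N * (ln (real N) + 4)"
    by (simp add: algebra_simps)
  then show ?thesis using assms by simp
qed

lemma sum_mangoldt_over_ge:
  assumes "N > 0"
  shows "(\<Sum>n\<in>{1..N}. mangoldt n / real n) \<ge> ln (real N) - 1"
proof -
  have "real N * (ln (real N) - 1) \<le> ln (fact N)" using ln_fact_ge[of N] by (simp add: algebra_simps)
  also have "\<dots> \<le> (\<Sum>n\<in>{1..N}. mangoldt n * (real N / real n))"
    unfolding ln_fact_eq_sum_mangoldt
    by (intro sum_mono mult_left_mono mangoldt_nonneg of_nat_div_le_of_nat)
  also have "\<dots> = real N * (\<Sum>n\<in>{1..N}. mangoldt n / real n)"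
    by (simp add: sum_distrib_left mult_ac)
  finally show ?thesis using assms by simp
qed

section \<open>The Moebius function and prime powers\<close>

lemma sum_divisors_prime_power_mult:
  fixes f :: "nat \<Rightarrow> 'a :: comm_monoid_add"
  assumes p: "prime p" and pm: "\<not> p dvd m"
  shows "(\<Sum>d | d dvd p ^ a * m. f d) = (\<Sum>i\<le>a. \<Sum>d | d dvd m. f (p ^ i * d))"
proof -
  have m: "m > 0" using pm by (cases m) auto
  have p0: "p > 0" using p by (simp add: prime_gt_0_nat)
  have inj: "inj_on (\<lambda>(i, d). p ^ i * d) ({..a} \<times> {d. d dvd m})"
  proof (rule inj_onI, clarsimp)
    fix i d j e assume d: "d dvd m" "e dvd m" and eq: "p ^ i * d = p ^ j * e"
    have "\<not> p dvd d" "\<not> p dvd e" using d pm dvd_trans by blast+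
    then have "multiplicity p (p ^ i * d) = i" "multiplicity p (p ^ j * e) = j"
      using p p0 by (auto intro!: multiplicity_decompose' multiplicity_eqI
        simp: multiplicity_eqI not_dvd_imp_multiplicity_0 multiplicity_prime_elem_times_other)
    then have "i = j" using eq by simp
    then show "i = j \<and> d = e" using eq p0 by simp
  qed
  have img: "(\<lambda>(i, d). p ^ i * d) ` ({..a} \<times> {d. d dvd m}) = {d. d dvd p ^ a * m}"
  proof (intro equalityI subsetI)
    fix x assume "x \<in> {d. d dvd p ^ a * m}"
    then obtain u d where x: "x = u * d" "u dvd p ^ a" "d dvd m"
      using division_decomp by blast
    then obtain i where "i \<le> a" "u = p ^ i" using divides_primepow_nat[OF p] by blast
    then show "x \<in> (\<lambda>(i, d). p ^ i * d) ` ({..a} \<times> {d. d dvd m})" using x by auto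
  qed (auto intro: mult_dvd_mono le_imp_power_dvd)
  have "(\<Sum>d | d dvd p ^ a * m. f d) = (\<Sum>(i, d)\<in>{..a} \<times> {d. d dvd m}. f (p ^ i * d))"
    unfolding img[symmetric] by (subst sum.reindex[OF inj]) (simp add: case_prod_unfold)
  also have "\<dots> = (\<Sum>i\<le>a. \<Sum>d | d dvd m. f (p ^ i * d))"
    by (rule sum.cartesian_product[symmetric])
  finally show ?thesis .
qed

lemma prime_power_mult_induct [consumes 1, case_names one step]:
  fixes P :: "nat \<Rightarrow> bool"
  assumes "n > 0" and one: "P 1"
    and step: "\<And>p a m. prime p \<Longrightarrow> a > 0 \<Longrightarrow> m > 0 \<Longrightarrow> \<not> p dvd m \<Longrightarrow> P m \<Longrightarrow> P (p ^ a * m)"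
  shows "P n"
  using assms(1)
proof (induction n rule: less_induct)
  case (less n)
  show ?case
  proof (cases "n = 1")
    case False
    then obtain p where p: "prime p" "p dvd n" using prime_factor_nat by blast
    obtain m where m: "n = p ^ multiplicity p n * m" "\<not> p dvd m"
      using multiplicity_decompose'[of n p] less.prems p(1) not_prime_unit by blast
    have a: "multiplicity p n > 0" using p less.prems by (simp add: prime_multiplicity_gt_zero_iff)
    have m0: "m > 0" using m(1) less.prems by (metis gr0I mult_0_right)
    have "p ^ multiplicity p n > 1" using a p prime_gt_1_nat one_less_power by blast
    then have "m < n" using m(1) m0 by (metis mult_less_cancel2 nat_mult_1)
    then show ?thesis using step[OF p(1) a m0 m(2)] less.IH m0 m(1) by metis
  qed (use one in simp)
qed

definition moebius_mu :: "nat \<Rightarrow> real" where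
  "moebius_mu n = (if squarefree n then (- 1) ^ card (prime_factors n) else 0)"

lemma abs_moebius_mu_le: "\<bar>moebius_mu n\<bar> \<le> 1"
  by (simp add: moebius_mu_def)

lemma moebius_mu_prime_mult:
  assumes p: "prime p" and d: "\<not> p dvd d"
  shows "moebius_mu (p * d) = - moebius_mu d"
proof -
  have "d \<noteq> 0" using d by (cases d) auto
  then have "prime_factors (p * d) = insert p (prime_factors d)" "p \<notin> prime_factors d"
    using p d by (auto simp: prime_factors_product prime_factorization_prime)
  moreover have "squarefree (p * d) \<longleftrightarrow> squarefree d"
    using p d squarefree_mult_coprime[of p d] squarefree_multD[of p d]
    by (auto simp: prime_imp_coprime squarefree_prime)
  ultimately show ?thesis by (simp add: moebius_mu_def)
qed

text \<open>For a prime power factor only the exponents 0 and 1 give squarefree divisors, and their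
  contributions cancel.\<close>

lemma sum_moebius_mu:
  assumes "n > 0"
  shows "(\<Sum>d | d dvd n. moebius_mu d) = (if n = 1 then 1 else 0)"
  using assms
proof (induction n rule: prime_power_mult_induct)
  case one
  then show ?case by (simp add: moebius_mu_def)
next
  case (step p a m)
  have "moebius_mu (p ^ i * d) = (if i = 0 then 1 else if i = 1 then - 1 else 0) * moebius_mu d"
    if "d dvd m" for i d
  proof -
    have nd: "\<not> p dvd d" using that step.hyps dvd_trans by blast
    have "\<not> squarefree (p ^ i * d)" if "i > 1"
    proof -
      have "p ^ 2 dvd p ^ i * d" using that by (intro dvd_mult2 le_imp_power_dvd) auto
      then show ?thesis using step.hyps(1) unfolding squarefree_def by (metis not_prime_unit)
    qed
    then have "moebius_mu (p ^ i * d) = 0" if "i > 1" using that by (simp add: moebius_mu_def)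
    then show ?thesis using moebius_mu_prime_mult[OF step.hyps(1) nd]
      by (cases "i > 1") (auto simp: not_less le_Suc_eq)
  qed
  then have "(\<Sum>d | d dvd p ^ a * m. moebius_mu d) =
      (\<Sum>i\<le>a. (if i = 0 then 1 else if i = 1 then - 1 else 0) * (\<Sum>d | d dvd m. moebius_mu d))"
    unfolding sum_divisors_prime_power_mult[OF step.hyps(1,4)] sum_distrib_left
    by (intro sum.cong) auto
  also have "\<dots> = (\<Sum>i\<in>{0, 1 :: nat}. (if i = 0 then 1 else if i = 1 then - 1 else 0) * (\<Sum>d | d dvd m. moebius_mu d))"
    by (rule sum.mono_neutral_right) (use step.hyps in auto)
  also have "\<dots> = 0" by simp
  finally show ?case using step.hyps by (auto simp: prime_gt_1_nat)
qed

text \<open>Moebius inversion of the identity that sums \<open>mangoldt\<close> over divisors to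
  \<open>ln n\<close>. After splitting \<open>ln (n div d)\<close> the part with \<open>ln n\<close>
  vanishes, for \<open>n = 1\<close> because \<open>ln 1 = 0\<close>.\<close>

lemma sum_moebius_mu_ln:
  assumes n: "n > 0"
  shows "(\<Sum>d | d dvd n. moebius_mu d * ln (real d)) = - mangoldt n"
proof -
  have "(\<Sum>d | d dvd n. moebius_mu d * ln (real (n div d))) =
      (\<Sum>d | d dvd n. \<Sum>e | e dvd n div d. moebius_mu d * mangoldt e)"
  proof (rule sum.cong[OF refl])
    fix d assume "d \<in> {d. d dvd n}"
    then have "n div d \<noteq> 0" using n by (auto elim!: dvdE)
    then show "moebius_mu d * ln (real (n div d)) = (\<Sum>e | e dvd n div d. moebius_mu d * mangoldt e)"
      using mangoldt_sum[of "n div d", where 'a = real] by (simp flip: sum_distrib_left)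
  qed
  also have "\<dots> = (\<Sum>(d, e)\<in>(SIGMA d:{d. d dvd n}. {e. e dvd n div d}). moebius_mu d * mangoldt e)"
    using n by (intro sum.Sigma) (auto elim!: dvdE)
  also have "\<dots> = (\<Sum>(e, d)\<in>(SIGMA e:{e. e dvd n}. {d. d dvd n div e}). moebius_mu d * mangoldt e)"
    by (rule sum.reindex_bij_witness[of _ "\<lambda>(d, e). (e, d)" "\<lambda>(d, e). (e, d)"])
      (use n in \<open>auto elim!: dvdE simp: mult_ac\<close>)
  also have "\<dots> = (\<Sum>e | e dvd n. \<Sum>d | d dvd n div e. moebius_mu d * mangoldt e)"
    using n by (intro sum.Sigma[symmetric]) (auto elim!: dvdE)
  also have "\<dots> = (\<Sum>e | e dvd n. if e = n then mangoldt n else 0)"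
  proof (rule sum.cong[OF refl])
    fix e assume "e \<in> {e. e dvd n}"
    then have "n div e > 0" "n div e = 1 \<longleftrightarrow> e = n" using n by (auto elim!: dvdE)
    then show "(\<Sum>d | d dvd n div e. moebius_mu d * mangoldt e) = (if e = n then mangoldt n else 0)"
      using sum_moebius_mu[of "n div e"] by (simp flip: sum_distrib_right)
  qed
  also have "\<dots> = mangoldt n" using n by simp
  finally have "(\<Sum>d | d dvd n. moebius_mu d * ln (real (n div d))) = mangoldt n" .
  moreover have "(\<Sum>d | d dvd n. moebius_mu d * ln (real (n div d))) =
      (\<Sum>d | d dvd n. moebius_mu d * ln (real n) - moebius_mu d * ln (real d))"
  proof (rule sum.cong[OF refl])
    fix d assume "d \<in> {d. d dvd n}"
    then have "d > 0" "d dvd n" using n by (auto intro: dvd_pos_nat)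
    then show "moebius_mu d * ln (real (n div d)) = moebius_mu d * ln (real n) - moebius_mu d * ln (real d)"
      using n by (simp add: real_of_nat_div ln_div right_diff_distrib)
  qed
  moreover have "(\<Sum>d | d dvd n. moebius_mu d * ln (real n)) = 0"
    using sum_moebius_mu[OF n] by (simp flip: sum_distrib_right)
  ultimately show ?thesis by (simp add: sum_subtractf)
qed

section \<open>The bounded contribution of proper prime powers\<close>

lemma sum_inverse_powers_le:
  assumes "p \<ge> 2"
  shows "(\<Sum>k\<in>{2..N}. 1 / real p ^ k) \<le> 2 / real p ^ 2"
proof -
  \<comment> \<open>The subtracted tail makes the induction close: for \<open>p \<ge> 2\<close> it
    shrinks by at least the term being added.\<close>
  have "(\<Sum>k\<in>{2..N}. 1 / real p ^ k) \<le> 2 / real p ^ 2 - 2 / real p ^ Suc N" if "N \<ge> 1"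
    using that
  proof (induction N rule: dec_induct)
    case base
    then show ?case using assms by (simp add: field_simps power2_eq_square)
  next
    case (step N)
    have "2 / real p ^ Suc (Suc N) \<le> 1 / real p ^ Suc N" using assms by (simp add: field_simps)
    moreover have "2 / real p ^ Suc N = 1 / real p ^ Suc N + 1 / real p ^ Suc N" by simp
    moreover have "(\<Sum>k\<in>{2..Suc N}. 1 / real p ^ k) = (\<Sum>k\<in>{2..N}. 1 / real p ^ k) + 1 / real p ^ Suc N"
      using step.hyps by simp
    ultimately show ?case using step.IH by linarith
  qed
  moreover have "2 / real p ^ Suc N \<ge> 0" by simp
  moreover have "(\<Sum>k\<in>{2..N}. 1 / real p ^ k) \<le> 2 / real p ^ 2" if "\<not> N \<ge> 1" using that by simp
  ultimately show ?thesis by (cases "N \<ge> 1") linarith+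
qed

text \<open>Off the primes, \<open>mangoldt\<close> lives on powers \<open>p ^ k\<close> with
  \<open>k \<ge> 2\<close>. Summing over \<open>k\<close> leaves about \<open>ln p / p ^ 2\<close>,
  a convergent series. This bound isolates primes in all later sums.\<close>

lemma sum_mangoldt_over_nonprime_bounded:
  "\<exists>K. \<forall>N. (\<Sum>n | n \<in> {1..N} \<and> \<not> prime n. mangoldt n / real n) \<le> K"
proof -
  have sm: "summable (\<lambda>p. 4 * real p powr (- 3 / 2))"
    by (intro summable_mult) (simp add: summable_real_powr_iff)
  have "(\<Sum>n | n \<in> {1..N} \<and> \<not> prime n. mangoldt n / real n) \<le> (\<Sum>p. 4 * real p powr (- 3 / 2))" for N
  proof -
    define A where "A = {p\<in>{2..N}. prime p} \<times> {2..N}"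
    define B where "B = {n. n \<in> {1..N} \<and> \<not> prime n \<and> primepow n}"
    have "(\<Sum>n | n \<in> {1..N} \<and> \<not> prime n. mangoldt n / real n) = (\<Sum>n\<in>B. mangoldt n / real n)"
      unfolding B_def by (rule sum.mono_neutral_right) (auto simp: mangoldt_def)
    also have "\<dots> \<le> (\<Sum>n\<in>(\<lambda>(p, k). p ^ k) ` A. mangoldt n / real n)"
    proof (rule sum_mono2)
      show "finite ((\<lambda>(p, k). p ^ k) ` A)" by (simp add: A_def)
      show "B \<subseteq> (\<lambda>(p, k). p ^ k) ` A"
      proof
        fix n assume "n \<in> B"
        then have n: "n \<le> N" "\<not> prime n" "primepow n" by (auto simp: B_def)
        then obtain p k where pk: "prime p" "k > 0" "n = p ^ k" by (auto simp: primepow_def)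
        have "k \<noteq> 1" using pk n by auto
        have p2: "p \<ge> 2" using pk by (simp add: prime_ge_2_nat)
        have "p ^ 1 \<le> p ^ k" using pk p2 by (intro power_increasing) auto
        moreover have "k < p ^ k" using p2 less_exp[of k] power_mono[of 2 p k] by linarith
        ultimately have "(p, k) \<in> A" using pk n p2 \<open>k \<noteq> 1\<close> by (auto simp: A_def)
        then show "n \<in> (\<lambda>(p, k). p ^ k) ` A" using pk by force
      qed
    qed (simp add: mangoldt_nonneg)
    also have "\<dots> \<le> (\<Sum>x\<in>A. (\<lambda>n. mangoldt n / real n) ((\<lambda>(p, k). p ^ k) x))"
      by (rule sum_image_le[unfolded comp_def]) (auto simp: A_def mangoldt_nonneg)
    also have "\<dots> = (\<Sum>(p, k)\<in>A. ln (real p) * (1 / real p ^ k))"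
      by (rule sum.cong) (auto simp: A_def)
    also have "\<dots> = (\<Sum>p | p \<in> {2..N} \<and> prime p. ln (real p) * (\<Sum>k\<in>{2..N}. 1 / real p ^ k))"
      unfolding A_def by (subst sum.cartesian_product[symmetric]) (simp add: sum_distrib_left)
    also have "\<dots> \<le> (\<Sum>p | p \<in> {2..N} \<and> prime p. 4 * real p powr (- 3 / 2))"
    proof (rule sum_mono)
      fix p assume p: "p \<in> {p. p \<in> {2..N} \<and> prime p}"
      \<comment> \<open>Passing through \<open>sqrt p\<close> bounds \<open>ln p\<close> by
        \<open>2 * sqrt p\<close>, enough for the summable exponent -3/2.\<close>
      have "ln (real p) = 2 * ln (sqrt (real p))" using p by (simp add: ln_sqrt)
      also have "\<dots> \<le> 2 * sqrt (real p)" using p ln_bound[of "sqrt (real p)"] by simp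
      finally have "ln (real p) * (\<Sum>k\<in>{2..N}. 1 / real p ^ k) \<le> 2 * sqrt (real p) * (2 / real p ^ 2)"
        using p by (intro mult_mono sum_inverse_powers_le) (auto intro: sum_nonneg)
      also have "\<dots> = 4 * (real p powr (1 / 2) * real p powr (- 2))"
        using p by (simp add: powr_half_sqrt powr_minus_divide powr_numeral)
      also have "\<dots> = 4 * real p powr (- 3 / 2)" by (simp flip: powr_add)
      finally show "ln (real p) * (\<Sum>k\<in>{2..N}. 1 / real p ^ k) \<le> 4 * real p powr (- 3 / 2)" .
    qed
    also have "\<dots> \<le> (\<Sum>p. 4 * real p powr (- 3 / 2))"
      by (rule sum_le_suminf[OF sm]) auto
    finally show ?thesis .
  qed
  then show ?thesis by blast
qed

section \<open>Nonprincipal characters at 1\<close>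

locale nonprincipal_char =
  fixes q :: nat and \<psi> :: "nat \<Rightarrow> complex"
  assumes q_pos: "q > 0" and char: "dirichlet_char q \<psi>" and nonprincipal: "\<psi> \<noteq> principal_char q"
begin

lemmas sum_bound = norm_sum_dirichlet_char_interval_le[OF char q_pos nonprincipal]
lemmas charD = dirichlet_charD[OF char]

definition L_partial :: "nat \<Rightarrow> complex" where
  "L_partial N = (\<Sum>n\<in>{1..N}. \<psi> n / of_nat n)"

definition L_one :: complex where
  "L_one = lim L_partial"

definition mangoldt_partial :: "nat \<Rightarrow> complex" where
  "mangoldt_partial N = (\<Sum>n\<in>{1..N}. \<psi> n * mangoldt n / of_nat n)"

lemma norm_L_partial_diff_le:
  assumes "N \<le> M"
  shows "norm (L_partial M - L_partial N) \<le> 2 * real q / (real N + 1)"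
proof -
  have split: "{1..M} = {1..N} \<union> {Suc N..<Suc M}" using assms by auto
  have "L_partial M = L_partial N + (\<Sum>n\<in>{Suc N..<Suc M}. \<psi> n / of_nat n)"
    unfolding L_partial_def split by (rule sum.union_disjoint) auto
  then have "L_partial M - L_partial N = (\<Sum>n\<in>{Suc N..<Suc M}. \<psi> n / of_nat n)" by simp
  also have "\<dots> = (\<Sum>n\<in>{Suc N..<Suc M}. \<psi> n * of_real (1 / real n))"
    by (simp add: field_simps)
  also have "norm \<dots> \<le> (2 * real q) * (1 / real (Suc N))"
    by (rule norm_sum_mult_decreasing_le) (use sum_bound in \<open>auto simp: frac_le\<close>)
  finally show ?thesis by (simp add: add.commute)
qed

lemma L_partial_tendsto: "L_partial \<longlonglongrightarrow> L_one"
proof -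
  have lim: "(\<lambda>N. 2 * real q / (real N + 1)) \<longlonglongrightarrow> 0"
    using tendsto_mult_left[OF LIMSEQ_inverse_real_of_nat, of "2 * real q"]
    by (simp add: divide_inverse add.commute)
  have "Cauchy L_partial"
  proof (rule CauchyI')
    fix e :: real assume "e > 0"
    then have "\<forall>\<^sub>F N in sequentially. 2 * real q / (real N + 1) < e"
      using lim by (intro order_tendstoD(2)) auto
    then obtain N0 where N0: "\<And>N. N \<ge> N0 \<Longrightarrow> 2 * real q / (real N + 1) < e"
      unfolding eventually_sequentially by blast
    have "norm (L_partial m - L_partial n) < e" if "m \<ge> N0" "n > m" for m n
      using norm_L_partial_diff_le[of m n] N0[of m] that by (simp add: norm_minus_commute)
    then show "\<exists>M. \<forall>m\<ge>M. \<forall>n>m. dist (L_partial m) (L_partial n) < e"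
      unfolding dist_norm by blast
  qed
  then show ?thesis unfolding L_one_def using Cauchy_convergent convergent_LIMSEQ_iff by blast
qed

lemma norm_L_partial_minus_L_one_le: "norm (L_partial N - L_one) \<le> 2 * real q / (real N + 1)"
proof (rule LIMSEQ_le_const2)
  show "(\<lambda>M. norm (L_partial N - L_partial M)) \<longlonglongrightarrow> norm (L_partial N - L_one)"
    by (intro tendsto_intros L_partial_tendsto)
  show "\<exists>K. \<forall>M\<ge>K. norm (L_partial N - L_partial M) \<le> 2 * real q / (real N + 1)"
    using norm_L_partial_diff_le[of N] by (auto simp: norm_minus_commute)
qed

text \<open>In the convolution sums below, the factor \<open>d / N\<close> cancels the
  \<open>1 / d\<close> carried by each coefficient, so the total error is \<open>1 / N\<close> times
  a sum of size O(N).\<close>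

lemma norm_L_partial_div_le:
  assumes "d > 0" "N > 0"
  shows "norm (L_partial (N div d) - L_one) \<le> 2 * real q * (real d / real N)"
proof -
  have "real N / real d \<le> real (N div d) + 1" by (rule divide_le_div_add_one)
  then have "1 / (real (N div d) + 1) \<le> 1 / (real N / real d)"
    using assms by (intro frac_le) auto
  then have "2 * real q * (1 / (real (N div d) + 1)) \<le> 2 * real q * (1 / (real N / real d))"
    by (intro mult_left_mono) auto
  then show ?thesis using norm_L_partial_minus_L_one_le[of "N div d"] by simp
qed

lemma sum_ln_over_bounded: "\<exists>C. \<forall>N. norm (\<Sum>n\<in>{1..N}. \<psi> n * of_real (ln (real n) / real n)) \<le> C"
proof -
  define F where "F = (\<lambda>N. \<Sum>n\<in>{1..N}. \<psi> n * of_real (ln (real n) / real n))"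
  have "norm (F N) \<le> norm (F 1) + norm (F 2) + 2 * real q * (ln (real 3) / real 3)" for N
  proof (cases "N \<ge> 2")
    case True
    \<comment> \<open>\<open>ln x / x\<close> decreases only from e on, so Abel summation starts at
      3 and the first two terms are kept apart.\<close>
    then have split: "{1..N} = {1..2} \<union> {3..<Suc N}" by auto
    have "F N = F 2 + (\<Sum>n\<in>{3..<Suc N}. \<psi> n * of_real (ln (real n) / real n))"
      unfolding F_def split by (rule sum.union_disjoint) auto
    moreover have "norm (\<Sum>n\<in>{3..<Suc N}. \<psi> n * of_real (ln (real n) / real n)) \<le> (2 * real q) * (ln (real 3) / real 3)"
    proof (rule norm_sum_mult_decreasing_le)
      show "norm (sum \<psi> {3..<N}) \<le> 2 * real q" for N using sum_bound[of 3 N] by simp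
      show "ln (real (Suc n)) / real (Suc n) \<le> ln (real n) / real n" if "n \<ge> 3" for n
        using that exp_le by (intro ln_x_over_x_mono) auto
    qed auto
    ultimately show ?thesis
      using norm_triangle_ineq[of "F 2" "F N - F 2"] by (smt (verit) add_diff_cancel_left' norm_ge_zero)
  next
    case False
    then have "N = 0 \<or> N = 1" by auto
    then show ?thesis by (auto simp: F_def)
  qed
  then show ?thesis unfolding F_def by blast
qed

text \<open>Writing \<open>ln\<close> as a divisor sum of \<open>mangoldt\<close> turns the bounded
  sum of \<open>\<psi> n * ln n / n\<close> into a combination of
  \<open>L_partial (N div d)\<close>. Replacing these by \<open>L_one\<close> costs at most
  \<open>8 * q\<close>, where 8 is 2 from the tail bound times 4 from Chebyshev.\<close>

lemma mangoldt_partial_bounded: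
  assumes "L_one \<noteq> 0"
  shows "\<exists>C. \<forall>N. norm (mangoldt_partial N) \<le> C"
proof -
  obtain C where C: "\<And>N. norm (\<Sum>n\<in>{1..N}. \<psi> n * of_real (ln (real n) / real n)) \<le> C"
    using sum_ln_over_bounded by blast
  have "norm (L_one * mangoldt_partial N) \<le> C + 8 * real q" if N: "N > 0" for N
  proof -
    define g where "g = (\<lambda>d. \<psi> d * mangoldt d / of_nat d)"
    have "(\<Sum>n\<in>{1..N}. \<psi> n * of_real (ln (real n) / real n)) =
        (\<Sum>n\<in>{1..N}. \<Sum>d | d dvd n. g d * (\<psi> (n div d) / of_nat (n div d)))"
    proof (rule sum.cong[OF refl])
      fix n assume n: "n \<in> {1..N}"
      have "\<psi> n * of_real (ln (real n) / real n) = \<psi> n / of_nat n * (\<Sum>d | d dvd n. mangoldt d)"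
        using n mangoldt_sum[of n, where 'a = complex] by simp
      also have "\<dots> = (\<Sum>d | d dvd n. \<psi> n / of_nat n * mangoldt d)" by (rule sum_distrib_left)
      also have "\<dots> = (\<Sum>d | d dvd n. g d * (\<psi> (n div d) / of_nat (n div d)))"
      proof (rule sum.cong[OF refl])
        fix d assume "d \<in> {d. d dvd n}"
        then obtain m where "n = d * m" by blast
        then show "\<psi> n / of_nat n * mangoldt d = g d * (\<psi> (n div d) / of_nat (n div d))"
          using n by (simp add: g_def charD(1))
      qed
      finally show "\<psi> n * of_real (ln (real n) / real n) = (\<Sum>d | d dvd n. g d * (\<psi> (n div d) / of_nat (n div d)))" .
    qed
    also have "\<dots> = (\<Sum>d\<in>{1..N}. g d * L_partial (N div d))"
      by (subst sum_divisors_swap[of "\<lambda>d m. g d * (\<psi> m / of_nat m)"]) (simp add: L_partial_def sum_distrib_left)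
    finally have swap: "(\<Sum>n\<in>{1..N}. \<psi> n * of_real (ln (real n) / real n)) = (\<Sum>d\<in>{1..N}. g d * L_partial (N div d))" .
    have "L_one * mangoldt_partial N = (\<Sum>d\<in>{1..N}. g d * L_one)"
      by (simp add: mangoldt_partial_def g_def sum_distrib_left mult_ac)
    then have eq: "(\<Sum>n\<in>{1..N}. \<psi> n * of_real (ln (real n) / real n)) - L_one * mangoldt_partial N =
        (\<Sum>d\<in>{1..N}. g d * (L_partial (N div d) - L_one))"
      unfolding swap by (simp add: right_diff_distrib sum_subtractf)
    have "norm (\<Sum>d\<in>{1..N}. g d * (L_partial (N div d) - L_one)) \<le> (\<Sum>d\<in>{1..N}. 2 * real q / real N * mangoldt d)"
    proof (rule sum_norm_le)
      fix d assume d: "d \<in> {1..N}"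
      have "norm (g d) \<le> mangoldt d / real d"
        using norm_dirichlet_char_le[OF char q_pos, of d]
        by (auto simp: g_def norm_mult norm_divide mangoldt_nonneg intro!: divide_right_mono mult_left_le_one_le)
      then have "norm (g d) * norm (L_partial (N div d) - L_one) \<le> mangoldt d / real d * (2 * real q * (real d / real N))"
        using d N by (intro mult_mono norm_L_partial_div_le) (auto simp: mangoldt_nonneg)
      then show "norm (g d * (L_partial (N div d) - L_one)) \<le> 2 * real q / real N * mangoldt d"
        unfolding norm_mult using d by (simp add: field_simps)
    qed
    also have "\<dots> = 2 * real q / real N * (\<Sum>d\<in>{1..N}. mangoldt d)" by (simp add: sum_distrib_left)
    also have "\<dots> \<le> 2 * real q / real N * (4 * real N)"
      by (intro mult_left_mono sum_mangoldt_le) auto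
    also have "\<dots> = 8 * real q" using N by simp
    finally show ?thesis
      using C[of N] norm_triangle_sub[of "L_one * mangoldt_partial N" "\<Sum>n\<in>{1..N}. \<psi> n * of_real (ln (real n) / real n)"]
      unfolding norm_minus_commute[of "L_one * mangoldt_partial N"] eq by linarith
  qed
  then have "norm (mangoldt_partial N) \<le> (C + 8 * real q) / norm L_one" if "N > 0" for N
    using that assms by (simp add: norm_mult field_simps)
  moreover have "mangoldt_partial 0 = 0" by (simp add: mangoldt_partial_def)
  moreover have "C \<ge> 0" using C[of 0] by simp
  ultimately have "norm (mangoldt_partial N) \<le> (C + 8 * real q) / norm L_one" for N
    by (cases "N = 0") auto
  then show ?thesis by blast
qed

text \<open>When the limit vanishes, every \<open>L_partial (N div d)\<close> is itself an error
  term, so any convolution with suitably small coefficients is bounded. The coefficients are chosen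
  so that the convolution equals the left-hand side.\<close>

lemma mangoldt_partial_plus_ln_bounded:
  assumes "L_one = 0" and N: "N > 0"
  shows "norm (mangoldt_partial N + of_real (ln (real N))) \<le> 2 * real q"
proof -
  \<comment> \<open>By Moebius inversion the weights \<open>moebius_mu d * ln (N / d)\<close> sum
    over the divisors of \<open>n\<close> to \<open>mangoldt n\<close>, plus \<open>ln N\<close>
    when \<open>n = 1\<close>.\<close>
  define g where "g = (\<lambda>d. \<psi> d * of_real (moebius_mu d * ln (real N / real d)) / of_nat d)"
  have "(\<Sum>d\<in>{1..N}. g d * L_partial (N div d)) =
      (\<Sum>n\<in>{1..N}. \<Sum>d | d dvd n. g d * (\<psi> (n div d) / of_nat (n div d)))"
    by (subst sum_divisors_swap[of "\<lambda>d m. g d * (\<psi> m / of_nat m)"]) (simp add: L_partial_def sum_distrib_left)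
  also have "\<dots> =
      (\<Sum>n\<in>{1..N}. (if n = 1 then of_real (ln (real N)) else 0) + \<psi> n * mangoldt n / of_nat n)"
  proof (rule sum.cong[OF refl])
    fix n assume n: "n \<in> {1..N}"
    have "(\<Sum>d | d dvd n. g d * (\<psi> (n div d) / of_nat (n div d))) =
        (\<Sum>d | d dvd n. \<psi> n / of_nat n * of_real (moebius_mu d * ln (real N) - moebius_mu d * ln (real d)))"
    proof (rule sum.cong[OF refl])
      fix d assume "d \<in> {d. d dvd n}"
      then obtain m where m: "n = d * m" by blast
      then have "d > 0" using n by (cases d) auto
      then show "g d * (\<psi> (n div d) / of_nat (n div d)) =
          \<psi> n / of_nat n * of_real (moebius_mu d * ln (real N) - moebius_mu d * ln (real d))"
        using n m N by (simp add: g_def charD(1) ln_div algebra_simps diff_divide_distrib)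
    qed
    also have "\<dots> = \<psi> n / of_nat n * of_real ((\<Sum>d | d dvd n. moebius_mu d) * ln (real N) - (\<Sum>d | d dvd n. moebius_mu d * ln (real d)))"
      by (simp add: sum_distrib_left sum_distrib_right sum_subtractf right_diff_distrib)
    also have "\<dots> = \<psi> n / of_nat n * of_real ((if n = 1 then ln (real N) else 0) + mangoldt n)"
      using n by (simp add: sum_moebius_mu sum_moebius_mu_ln)
    also have "\<dots> = (if n = 1 then of_real (ln (real N)) else 0) + \<psi> n * mangoldt n / of_nat n"
      by (simp add: charD)
    finally show "(\<Sum>d | d dvd n. g d * (\<psi> (n div d) / of_nat (n div d))) = 
      (if n = 1 then of_real (ln (real N)) else 0) + \<psi> n * mangoldt n / of_nat n" .
  qed
  also have "\<dots> = of_real (ln (real N)) + mangoldt_partial N"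
    using N by (simp add: sum.distrib mangoldt_partial_def)
  finally have eq: "mangoldt_partial N + of_real (ln (real N)) = (\<Sum>d\<in>{1..N}. g d * L_partial (N div d))"
    by (simp add: add.commute)
  have "norm (\<Sum>d\<in>{1..N}. g d * L_partial (N div d)) \<le> (\<Sum>d\<in>{1..N}. 2 * real q / real N * (ln (real N) - ln (real d)))"
  proof (rule sum_norm_le)
    fix d assume d: "d \<in> {1..N}"
    have ln: "ln (real N / real d) = ln (real N) - ln (real d)" "ln (real N) - ln (real d) \<ge> 0"
      using d N by (auto simp: ln_div)
    have "norm (g d) = norm (\<psi> d) * \<bar>moebius_mu d\<bar> * \<bar>ln (real N / real d)\<bar> / real d"
      by (simp add: g_def norm_mult norm_divide)
    also have "\<dots> = norm (\<psi> d) * \<bar>moebius_mu d\<bar> * (ln (real N) - ln (real d)) / real d"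
      using ln by simp
    also have "\<dots> \<le> 1 * 1 * (ln (real N) - ln (real d)) / real d"
      using ln norm_dirichlet_char_le[OF char q_pos, of d] abs_moebius_mu_le[of d]
      by (intro divide_right_mono mult_right_mono mult_mono) auto
    finally have "norm (g d) * norm (L_partial (N div d)) \<le> (ln (real N) - ln (real d)) / real d * (2 * real q * (real d / real N))"
      using d N ln norm_L_partial_div_le[of d N] assms(1) by (intro mult_mono) auto
    then show "norm (g d * L_partial (N div d)) \<le> 2 * real q / real N * (ln (real N) - ln (real d))"
      unfolding norm_mult using d by (simp add: mult_ac)
  qed
  \<comment> \<open>The total of \<open>ln (N / d)\<close> is \<open>N * ln N - ln (fact N)\<close>,
    at most \<open>N\<close> by the Stirling bound.\<close>
  also have "\<dots> = 2 * real q / real N * (real N * ln (real N) - ln (fact N))"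
    unfolding sum_distrib_left[symmetric] by (simp add: sum_subtractf ln_fact_eq_sum)
  also have "\<dots> \<le> 2 * real q / real N * real N"
    using ln_fact_ge[of N] by (intro mult_left_mono) auto
  also have "\<dots> = 2 * real q" using N by simp
  finally show ?thesis using eq by simp
qed

end

section \<open>Nonvanishing for real characters\<close>

lemma sum_powers_sign:
  fixes r :: real
  assumes "r = - 1 \<or> r = 0 \<or> r = 1"
  shows "(\<Sum>i\<le>a. r ^ i) \<ge> 0" "even a \<Longrightarrow> (\<Sum>i\<le>a. r ^ i) \<ge> 1"
proof -
  have *: "(\<Sum>i\<le>a. (- 1 :: real) ^ i) = (if even a then 1 else 0)" by (induction a) auto
  have **: "(\<Sum>i\<le>a. (0 :: real) ^ i) = 1" by (induction a) auto
  show "(\<Sum>i\<le>a. r ^ i) \<ge> 0" "even a \<Longrightarrow> (\<Sum>i\<le>a. r ^ i) \<ge> 1"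
    using assms * ** by (elim disjE; simp)+
qed

text \<open>The inequality of the arithmetic and geometric means for
  \<open>1, s ^ 2, ..., s ^ (2 * (n - 1))\<close>, whose geometric mean is
  \<open>s ^ (n - 1)\<close>; the extra factor \<open>s\<close> avoids the predecessor. Induction by
  two adds one outer pair of terms at a time.\<close>

lemma geometric_sum_ge:
  fixes s :: real
  assumes "0 < s"
  shows "real n * s ^ n \<le> s * (\<Sum>i<n. (s ^ 2) ^ i)"
proof (induction n rule: nat_induct2)
  case (step n)
  \<comment> \<open>The mean inequality for the outermost terms \<open>1\<close> and
    \<open>(s ^ 2) ^ (n + 1)\<close>; the inner terms are \<open>s ^ 2\<close> times the sum for
    \<open>n\<close>.\<close>
  have "0 \<le> (1 - s ^ (n + 1)) ^ 2" by simp
  then have *: "2 * s ^ (n + 1) \<le> 1 + (s ^ 2) ^ (n + 1)"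
    by (simp add: power2_eq_square power_mult_distrib algebra_simps flip: power_add power_mult)
  have "(\<Sum>i<n + 2. (s ^ 2) ^ i) = 1 + s ^ 2 * (\<Sum>i<n. (s ^ 2) ^ i) + (s ^ 2) ^ (n + 1)"
    using sum.lessThan_Suc_shift[of "\<lambda>i. (s ^ 2) ^ i" n] by (simp add: sum_distrib_left)
  then have "s * (\<Sum>i<n + 2. (s ^ 2) ^ i) = s * (1 + (s ^ 2) ^ (n + 1)) + s ^ 2 * (s * (\<Sum>i<n. (s ^ 2) ^ i))"
    by (simp add: algebra_simps)
  moreover have "s * (2 * s ^ (n + 1)) \<le> s * (1 + (s ^ 2) ^ (n + 1))" using * assms by simp
  moreover have "s ^ 2 * (real n * s ^ n) \<le> s ^ 2 * (s * (\<Sum>i<n. (s ^ 2) ^ i))"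
    using step.IH by (intro mult_left_mono) auto
  moreover have "real (n + 2) * s ^ (n + 2) = s * (2 * s ^ (n + 1)) + s ^ 2 * (real n * s ^ n)"
    by (simp add: algebra_simps power2_eq_square)
  ultimately show ?case by linarith
qed auto

text \<open>The weights \<open>w n\<close> below are \<open>1 - t\<close> times the difference between \<open>1 / (n (1 - t))\<close> and
  the Lambert coefficient \<open>t\<^sup>n / (1 - t\<^sup>n)\<close>; taking \<open>t = s\<^sup>2\<close> avoids square roots in the
  inequality between the arithmetic and the geometric mean.\<close>

lemma lambert_weight_decreasing:
  fixes s :: real
  assumes s: "0 < s" "s < 1"
  defines "A \<equiv> \<lambda>n. \<Sum>i<n. (s ^ 2) ^ i"
  defines "w \<equiv> \<lambda>n. 1 / real n - (s ^ 2) ^ n / A n"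
  assumes n: "n \<ge> 1"
  shows "w (Suc n) \<le> w n" "w n \<ge> 0"
proof -
  have pos: "A k > 0" if "k \<ge> 1" for k
    unfolding A_def using that s by (intro sum_pos) (auto simp: lessThan_empty_iff)
  have A_Suc: "A (Suc n) = 1 + s ^ 2 * A n"
    unfolding A_def by (subst sum.lessThan_Suc_shift) (simp add: sum_distrib_left)
  have "(s ^ 2) ^ n / A n - (s ^ 2) ^ Suc n / A (Suc n) = (s ^ 2) ^ n * (A (Suc n) - s ^ 2 * A n) / (A n * A (Suc n))"
    using pos[of n] pos[of "Suc n"] n by (simp add: field_simps)
  also have "\<dots> = (s ^ 2) ^ n / (A n * A (Suc n))" unfolding A_Suc by simp
  finally have diff: "(s ^ 2) ^ n / A n - (s ^ 2) ^ Suc n / A (Suc n) = (s ^ 2) ^ n / (A n * A (Suc n))" .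
  have gs: "real k * s ^ k \<le> s * A k" for k
    unfolding A_def by (rule geometric_sum_ge[OF s(1)])
  \<comment> \<open>Multiplying the mean inequalities for \<open>n\<close> and \<open>Suc n\<close>
    gives the odd power \<open>s ^ (2 * n + 1)\<close>; one factor \<open>s\<close> cancels and the
    other is bounded by 1.\<close>
  have "(real n * s ^ n) * (real (Suc n) * s ^ Suc n) \<le> (s * A n) * (s * A (Suc n))"
    by (rule mult_mono[OF gs gs]) (use s pos[of n] n in auto)
  then have "s * (real n * real (Suc n) * (s ^ 2) ^ n) \<le> s * (s * (A n * A (Suc n)))"
    by (simp add: power2_eq_square power_mult_distrib algebra_simps flip: power_mult)
  then have "real n * real (Suc n) * (s ^ 2) ^ n \<le> s * (A n * A (Suc n))" using s by simp
  also have "\<dots> \<le> 1 * (A n * A (Suc n))"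
    using s pos[of n] pos[of "Suc n"] n by (intro mult_right_mono) auto
  finally have "(s ^ 2) ^ n / (A n * A (Suc n)) \<le> 1 / (real n * real (Suc n))"
    using pos[of n] pos[of "Suc n"] n by (simp add: field_simps del: of_nat_Suc)
  also have "\<dots> = 1 / real n - 1 / real (Suc n)" using n by (simp add: field_simps)
  finally show "w (Suc n) \<le> w n" using diff by (simp add: w_def)
  have "real n * (s ^ 2) ^ n = (\<Sum>i<n. (s ^ 2) ^ n)" by simp
  also have "\<dots> \<le> A n" unfolding A_def using s by (intro sum_mono power_decreasing) (auto simp: power_le_one)
  finally show "w n \<ge> 0" using pos[of n] n by (simp add: w_def field_simps)
qed

section \<open>Lambert series of a real character\<close>

context nonprincipal_char
begin

lemma real_char_cases:
  assumes "\<And>n. cnj (\<psi> n) = \<psi> n"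
  shows "Re (\<psi> n) = - 1 \<or> Re (\<psi> n) = 0 \<or> Re (\<psi> n) = 1"
proof -
  have "\<psi> n = of_real (Re (\<psi> n))" using assms[of n] by (simp add: complex_eq_iff)
  then have "norm (\<psi> n) = \<bar>Re (\<psi> n)\<bar>" by (metis norm_of_real)
  then show ?thesis using norm_dirichlet_char[OF char q_pos, of n] by (auto split: if_splits)
qed

lemma Re_char_mult:
  assumes "\<And>n. cnj (\<psi> n) = \<psi> n"
  shows "Re (\<psi> (m * n)) = Re (\<psi> m) * Re (\<psi> n)" "Re (\<psi> (n ^ k)) = Re (\<psi> n) ^ k"
proof -
  have "Im (\<psi> n) = 0" for n using assms[of n] by (simp add: complex_eq_iff)
  then show *: "Re (\<psi> (m * n)) = Re (\<psi> m) * Re (\<psi> n)" for m n by (simp add: charD(1))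
  show "Re (\<psi> (n ^ k)) = Re (\<psi> n) ^ k" by (induction k) (simp_all add: * charD(4))
qed

text \<open>The divisor sum is multiplicative with local factors \<open>1 + r + ... + r ^ a\<close>,
  where \<open>r\<close> is -1, 0 or 1. These are nonnegative, and at least 1 for the even exponents
  of a square.\<close>

lemma sum_divisors_real_char_ge:
  assumes real: "\<And>n. cnj (\<psi> n) = \<psi> n" and "n > 0"
  shows "(\<Sum>d | d dvd n. Re (\<psi> d)) \<ge> 0 \<and> (\<Sum>d | d dvd n ^ 2. Re (\<psi> d)) \<ge> 1"
  using assms(2)
proof (induction n rule: prime_power_mult_induct)
  case one
  then show ?case by (simp add: charD)
next
  case (step p a m)
  have mult: "(\<Sum>d | d dvd p ^ a * m. Re (\<psi> d)) = (\<Sum>i\<le>a. Re (\<psi> p) ^ i) * (\<Sum>d | d dvd m. Re (\<psi> d))"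
    if "\<not> p dvd m" for a m
    unfolding sum_divisors_prime_power_mult[OF step.hyps(1) that] sum_product
    by (simp add: Re_char_mult[OF real])
  have "(p ^ a * m) ^ 2 = p ^ (2 * a) * m ^ 2" by (simp add: power_mult_distrib power_mult[symmetric] mult.commute)
  moreover have "\<not> p dvd m ^ 2" using step.hyps prime_dvd_power by blast
  ultimately have "(\<Sum>d | d dvd (p ^ a * m) ^ 2. Re (\<psi> d)) =
      (\<Sum>i\<le>2 * a. Re (\<psi> p) ^ i) * (\<Sum>d | d dvd m ^ 2. Re (\<psi> d))" using mult by simp
  moreover have "1 * 1 \<le> (\<Sum>i\<le>2 * a. Re (\<psi> p) ^ i) * (\<Sum>d | d dvd m ^ 2. Re (\<psi> d))"
    using step.IH sum_powers_sign(2)[OF real_char_cases[OF real, of p], of "2 * a"]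
    by (intro mult_mono) auto
  moreover have "0 \<le> (\<Sum>i\<le>a. Re (\<psi> p) ^ i) * (\<Sum>d | d dvd m. Re (\<psi> d))"
    using step.IH sum_powers_sign(1)[OF real_char_cases[OF real, of p], of a] by simp
  ultimately show ?case using mult[OF step.hyps(4), of a] by simp
qed

text \<open>Expanding each Lambert term into a geometric series produces the divisor sums. Abel
  summation compares the Lambert coefficients with \<open>1 / n\<close> at a cost proportional to
  \<open>1 - s ^ 2\<close>, so that dividing by this factor leaves a bound uniform in
  \<open>s\<close> once \<open>L_one = 0\<close>.\<close>

lemma lambert_partial_sum_le:
  fixes s :: real
  assumes real: "\<And>n. cnj (\<psi> n) = \<psi> n" and s: "0 < s" "s < 1"
  shows "(1 - s ^ 2) * (\<Sum>m\<in>{1..N}. (\<Sum>d | d dvd m. Re (\<psi> d)) * (s ^ 2) ^ m)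
    \<le> norm (L_partial N) + 2 * real q * (1 - s ^ 2) + real N * (s ^ 2) ^ N"
proof -
  define t where "t = s ^ 2"
  have t: "0 < t" "t < 1" using s by (auto simp: t_def power_less_one_iff)
  define A where "A = (\<lambda>n. \<Sum>i<n. t ^ i)"
  define w where "w = (\<lambda>n. 1 / real n - t ^ n / A n)"
  have A_ge: "A n \<ge> 1" if "n \<ge> 1" for n
  proof -
    have "(\<Sum>i\<in>{0}. t ^ i) \<le> A n" unfolding A_def using that t by (intro sum_mono2) auto
    then show ?thesis by simp
  qed
  have A_eq: "(1 - t) * A n = 1 - t ^ n" for n unfolding A_def by (rule one_diff_power_eq[symmetric])
  have "norm (\<Sum>n\<in>{1..<Suc N}. \<psi> n * of_real (w n)) \<le> 2 * real q * w 1"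
    unfolding w_def A_def t_def
    by (rule norm_sum_mult_decreasing_le) (use sum_bound lambert_weight_decreasing[OF s] in auto)
  \<comment> \<open>The first weight alone enters the Abel bound, and this is where the crucial
    factor \<open>1 - t\<close> comes from.\<close>
  moreover have "w 1 = 1 - t" by (simp add: w_def A_def)
  moreover have "(\<Sum>n\<in>{1..<Suc N}. \<psi> n * of_real (w n)) = L_partial N - (\<Sum>n\<in>{1..N}. \<psi> n * of_real (t ^ n / A n))"
    by (simp add: w_def L_partial_def sum_subtractf right_diff_distrib atLeastLessThanSuc_atLeastAtMost)
  ultimately have "norm (\<Sum>n\<in>{1..N}. \<psi> n * of_real (t ^ n / A n)) \<le> norm (L_partial N) + 2 * real q * (1 - t)"
    using norm_triangle_sub[of "\<Sum>n\<in>{1..N}. \<psi> n * of_real (t ^ n / A n)" "L_partial N"]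
    by (simp add: norm_minus_commute)
  then have main: "(\<Sum>n\<in>{1..N}. Re (\<psi> n) * (t ^ n / A n)) \<le> norm (L_partial N) + 2 * real q * (1 - t)"
    using complex_Re_le_cmod[of "\<Sum>n\<in>{1..N}. \<psi> n * of_real (t ^ n / A n)"] by simp
  have "(1 - t) * (\<Sum>m\<in>{1..N}. (\<Sum>d | d dvd m. Re (\<psi> d)) * t ^ m) =
      (1 - t) * (\<Sum>m\<in>{1..N}. \<Sum>d | d dvd m. Re (\<psi> d) * (t ^ d) ^ (m div d))"
    unfolding sum_distrib_right
    by (intro arg_cong[of _ _ "(*) (1 - t)"] sum.cong refl) (auto simp flip: power_mult)
  also have "\<dots> = (\<Sum>d\<in>{1..N}. Re (\<psi> d) * ((1 - t) * (\<Sum>j\<in>{1..N div d}. (t ^ d) ^ j)))"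
    by (subst sum_divisors_swap[of "\<lambda>d j. Re (\<psi> d) * (t ^ d) ^ j"]) (simp add: sum_distrib_left mult_ac)
  also have "\<dots> \<le> (\<Sum>d\<in>{1..N}. Re (\<psi> d) * (t ^ d / A d) + t ^ N)"
  proof (rule sum_mono)
    fix d assume d: "d \<in> {1..N}"
    define J where "J = N div d"
    have td: "t ^ d < 1" using t d by (simp add: power_less_one_iff)
    have "(1 - t) * (A d * (\<Sum>j\<in>{1..J}. (t ^ d) ^ j)) = (1 - t ^ d) * (\<Sum>j\<in>{1..J}. (t ^ d) ^ j)"
      by (simp flip: A_eq mult.assoc)
    also have "\<dots> = t ^ d * (1 - (t ^ d) ^ J)"
    proof (induction J)
      case (Suc J)
      have "(1 - t ^ d) * (\<Sum>j\<in>{1..Suc J}. (t ^ d) ^ j) =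
          (1 - t ^ d) * (\<Sum>j\<in>{1..J}. (t ^ d) ^ j) + (1 - t ^ d) * (t ^ d) ^ Suc J"
        by (simp add: distrib_left)
      also have "\<dots> = t ^ d * (1 - (t ^ d) ^ J) + (1 - t ^ d) * (t ^ d) ^ Suc J"
        by (simp only: Suc)
      also have "\<dots> = t ^ d * (1 - (t ^ d) ^ Suc J)" by (simp add: algebra_simps)
      finally show ?case .
    qed simp
    finally have eq: "(1 - t) * (\<Sum>j\<in>{1..J}. (t ^ d) ^ j) = t ^ d / A d - t ^ d * (t ^ d) ^ J / A d"
      using A_ge[of d] d by (simp add: field_simps)
    have "Re (\<psi> d) * ((1 - t) * (\<Sum>j\<in>{1..J}. (t ^ d) ^ j)) =
        Re (\<psi> d) * (t ^ d / A d) + (- Re (\<psi> d)) * (t ^ d * (t ^ d) ^ J / A d)"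
      unfolding eq by (simp add: right_diff_distrib)
    also have "(- Re (\<psi> d)) * (t ^ d * (t ^ d) ^ J / A d) \<le> 1 * t ^ N"
    proof (rule mult_mono)
      show "- Re (\<psi> d) \<le> 1" using real_char_cases[OF real, of d] by auto
      \<comment> \<open>The geometric series is cut after \<open>J = N div d\<close> terms. The next
        exponent \<open>d * (J + 1)\<close> is at least \<open>N\<close>, so each \<open>d\<close>
        loses at most \<open>t ^ N\<close>.\<close>
      have "N mod d < d" using d by simp
      then have "N \<le> d + d * J" using mult_div_mod_eq[of d N] unfolding J_def by linarith
      then have "t ^ (d + d * J) \<le> t ^ N" using t by (intro power_decreasing) auto
      then have "t ^ d * (t ^ d) ^ J \<le> t ^ N" by (simp add: power_add power_mult)
      moreover have "t ^ d * (t ^ d) ^ J / A d \<le> t ^ d * (t ^ d) ^ J / 1"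
        using A_ge[of d] d t by (intro divide_left_mono) auto
      ultimately show "t ^ d * (t ^ d) ^ J / A d \<le> t ^ N" by simp
    qed (use t A_ge[of d] d in auto)
    finally show "Re (\<psi> d) * ((1 - t) * (\<Sum>j\<in>{1..N div d}. (t ^ d) ^ j)) \<le> Re (\<psi> d) * (t ^ d / A d) + t ^ N"
      by (simp add: J_def)
  qed
  also have "\<dots> = (\<Sum>d\<in>{1..N}. Re (\<psi> d) * (t ^ d / A d)) + real N * t ^ N" by (simp add: sum.distrib)
  finally show ?thesis using main by (simp add: t_def)
qed

text \<open>If the value vanished, letting \<open>N\<close> tend to infinity and then
  \<open>s\<close> to 1 would bound all partial sums of the nonnegative coefficients
  \<open>c\<close> by \<open>2 * q\<close>, while every square contributes at least 1.\<close>

lemma L_one_nonzero_real: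
  assumes real: "\<And>n. cnj (\<psi> n) = \<psi> n"
  shows "L_one \<noteq> 0"
proof
  assume L: "L_one = 0"
  define c where "c = (\<lambda>m. \<Sum>d | d dvd m. Re (\<psi> d))"
  have c: "c m \<ge> 0" "c (m ^ 2) \<ge> 1" if "m > 0" for m
    using sum_divisors_real_char_ge[OF real that] by (auto simp: c_def)
  have bound: "(\<Sum>m\<in>{1..M}. c m * (s ^ 2) ^ m) \<le> 2 * real q" if s: "0 < s" "s < 1" for M and s :: real
  proof -
    have t: "0 < s ^ 2" "s ^ 2 < 1" using s by (auto simp: power_less_one_iff)
    have "(\<lambda>N. norm (L_partial N) + 2 * real q * (1 - s ^ 2) + real N * (s ^ 2) ^ N) \<longlonglongrightarrow>
        norm L_one + 2 * real q * (1 - s ^ 2) + 0"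
      using t by (intro tendsto_intros L_partial_tendsto powser_times_n_limit_0) auto
    moreover have "\<exists>K. \<forall>N\<ge>K. (1 - s ^ 2) * (\<Sum>m\<in>{1..M}. c m * (s ^ 2) ^ m) \<le>
        norm (L_partial N) + 2 * real q * (1 - s ^ 2) + real N * (s ^ 2) ^ N"
    proof (intro exI[of _ M] allI impI)
      fix N assume "N \<ge> M"
      then have "(\<Sum>m\<in>{1..M}. c m * (s ^ 2) ^ m) \<le> (\<Sum>m\<in>{1..N}. c m * (s ^ 2) ^ m)"
        using t c(1) by (intro sum_mono2) auto
      then have "(1 - s ^ 2) * (\<Sum>m\<in>{1..M}. c m * (s ^ 2) ^ m) \<le> (1 - s ^ 2) * (\<Sum>m\<in>{1..N}. c m * (s ^ 2) ^ m)"
        using t by (intro mult_left_mono) auto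
      also have "\<dots> \<le> norm (L_partial N) + 2 * real q * (1 - s ^ 2) + real N * (s ^ 2) ^ N"
        unfolding c_def by (rule lambert_partial_sum_le[OF real s])
      finally show "(1 - s ^ 2) * (\<Sum>m\<in>{1..M}. c m * (s ^ 2) ^ m) \<le>
        norm (L_partial N) + 2 * real q * (1 - s ^ 2) + real N * (s ^ 2) ^ N" .
    qed
    ultimately have "(1 - s ^ 2) * (\<Sum>m\<in>{1..M}. c m * (s ^ 2) ^ m) \<le> norm L_one + 2 * real q * (1 - s ^ 2) + 0"
      by (rule LIMSEQ_le_const)
    then have "(1 - s ^ 2) * (\<Sum>m\<in>{1..M}. c m * (s ^ 2) ^ m) \<le> (1 - s ^ 2) * (2 * real q)"
      using L by (simp add: mult_ac)
    then show ?thesis using t by simp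
  qed
  \<comment> \<open>For fixed \<open>M\<close> the sum is a polynomial in \<open>s\<close>, so the
    uniform bound passes to the left limit at 1.\<close>
  have bound1: "(\<Sum>m\<in>{1..M}. c m) \<le> 2 * real q" for M
  proof -
    have "((\<lambda>s :: real. \<Sum>m\<in>{1..M}. c m * (s ^ 2) ^ m) \<longlongrightarrow> (\<Sum>m\<in>{1..M}. c m * (1 ^ 2) ^ m)) (at_left 1)"
      by (intro tendsto_intros)
    moreover have "\<forall>\<^sub>F s :: real in at_left 1. (\<Sum>m\<in>{1..M}. c m * (s ^ 2) ^ m) \<le> 2 * real q"
    proof (rule eventually_mono)
      show "\<forall>\<^sub>F s :: real in at_left 1. s \<in> {0<..<1}" by (rule eventually_at_left_real) simp
    qed (intro bound; simp)
    ultimately have "(\<Sum>m\<in>{1..M}. c m * (1 ^ 2) ^ m) \<le> 2 * real q"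
      by (rule tendsto_upperbound) auto
    then show ?thesis by simp
  qed
  \<comment> \<open>One more square than the bound \<open>2 * q\<close> permits.\<close>
  define M where "M = 2 * q + 1"
  have "real M \<le> (\<Sum>k\<in>{1..M}. c (k ^ 2))"
    using sum_mono[of "{1..M}" "\<lambda>_. 1" "\<lambda>k. c (k ^ 2)"] c(2) by simp
  also have "\<dots> = (\<Sum>m\<in>(\<lambda>k. k ^ 2) ` {1..M}. c m)"
    by (subst sum.reindex) (auto simp: inj_on_def)
  also have "\<dots> \<le> (\<Sum>m\<in>{1..M ^ 2}. c m)"
    by (rule sum_mono2) (use c(1) in \<open>auto simp: power_mono Suc_le_eq\<close>)
  also have "\<dots> \<le> 2 * real q" by (rule bound1)
  finally show False by (simp add: M_def)
qed

end

section \<open>Dirichlet's theorem\<close>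

text \<open>An index not coprime to \<open>q\<close> is either nonprime or a prime divisor of
  \<open>q\<close>, hence at most \<open>q\<close>; both kinds contribute a bounded amount.\<close>

lemma principal_mangoldt_sum_ge:
  assumes q: "q > 0"
  shows "\<exists>K. \<forall>N>0. (\<Sum>n | n \<in> {1..N} \<and> coprime n q. mangoldt n / real n) \<ge> ln (real N) - K"
proof -
  obtain K where K: "\<And>N. (\<Sum>n | n \<in> {1..N} \<and> \<not> prime n. mangoldt n / real n) \<le> K"
    using sum_mangoldt_over_nonprime_bounded by blast
  define K' where "K' = (\<Sum>n\<in>{..q}. mangoldt n / real n)"
  have "ln (real N) - (1 + K + K') \<le> (\<Sum>n | n \<in> {1..N} \<and> coprime n q. mangoldt n / real n)" if N: "N > 0" for N
  proof -
    have sub: "{1..N} \<subseteq> {n. n \<in> {1..N} \<and> coprime n q} \<union> {n. n \<in> {1..N} \<and> \<not> prime n} \<union> {..q}"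
    proof
      fix n assume n: "n \<in> {1..N}"
      have "n \<le> q" if "prime n" "\<not> coprime n q"
        using that q prime_imp_coprime dvd_imp_le by blast
      then show "n \<in> {n. n \<in> {1..N} \<and> coprime n q} \<union> {n. n \<in> {1..N} \<and> \<not> prime n} \<union> {..q}"
        using n by auto
    qed
    have le: "sum f (A \<union> B) \<le> sum f A + sum f B" if "finite A" "finite B" "\<And>x. f x \<ge> (0 :: real)"
      for f and A B :: "nat set"
      using that sum.union_inter[of A B f] sum_nonneg[of "A \<inter> B" f] by simp
    have nn: "mangoldt n / real n \<ge> (0 :: real)" for n by (simp add: mangoldt_nonneg)
    have "ln (real N) - 1 \<le> (\<Sum>n\<in>{1..N}. mangoldt n / real n)" by (rule sum_mangoldt_over_ge[OF N])
    also have "\<dots> \<le> (\<Sum>n\<in>{n. n \<in> {1..N} \<and> coprime n q} \<union> {n. n \<in> {1..N} \<and> \<not> prime n} \<union> {..q}. mangoldt n / real n)"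
      using sub nn by (intro sum_mono2) auto
    also have "\<dots> \<le> (\<Sum>n\<in>{n. n \<in> {1..N} \<and> coprime n q} \<union> {n. n \<in> {1..N} \<and> \<not> prime n}. mangoldt n / real n) + K'"
      unfolding K'_def using nn by (intro le) auto
    also have "\<dots> \<le> (\<Sum>n | n \<in> {1..N} \<and> coprime n q. mangoldt n / real n) + (\<Sum>n | n \<in> {1..N} \<and> \<not> prime n. mangoldt n / real n) + K'"
      using nn by (intro add_right_mono le) auto
    also have "\<dots> \<le> (\<Sum>n | n \<in> {1..N} \<and> coprime n q. mangoldt n / real n) + K + K'"
      using K[of N] by simp
    finally show ?thesis by simp
  qed
  then show ?thesis by blast
qed

definition char_mangoldt_sum :: "(nat \<Rightarrow> complex) \<Rightarrow> nat \<Rightarrow> real" where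
  "char_mangoldt_sum \<psi> N = Re (\<Sum>n\<in>{1..N}. \<psi> n * mangoldt n / of_nat n)"

lemma char_mangoldt_sum_principal:
  "char_mangoldt_sum (principal_char q) N = (\<Sum>n | n \<in> {1..N} \<and> coprime n q. mangoldt n / real n)"
proof -
  have "(\<Sum>n\<in>{1..N}. principal_char q n * mangoldt n / of_nat n) =
      (\<Sum>n\<in>{1..N}. if coprime n q then of_real (mangoldt n / real n) else 0)"
    by (rule sum.cong) (auto simp: principal_char_def)
  also have "\<dots> = of_real (\<Sum>n | n \<in> {1..N} \<and> coprime n q. mangoldt n / real n)"
    by (subst sum.inter_filter[symmetric]) auto
  finally show ?thesis unfolding char_mangoldt_sum_def by simp
qed

text \<open>The factor \<open>\<psi> b\<close>, with \<open>b\<close> inverse to \<open>a\<close>,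
  plays the role of the conjugate of \<open>\<psi> a\<close>: orthogonality at \<open>b * n\<close>
  detects the class of \<open>a\<close>.\<close>

lemma sum_char_mangoldt_sums:
  assumes q: "q > 0" and a: "coprime a q" and b: "[a * b = 1] (mod q)"
  shows "(\<Sum>\<psi> | dirichlet_char q \<psi>. Re (\<Sum>n\<in>{1..N}. \<psi> b * \<psi> n * mangoldt n / of_nat n)) =
    real (card {\<psi>. dirichlet_char q \<psi>}) * (\<Sum>n | n \<in> {1..N} \<and> [n = a] (mod q). mangoldt n / real n)"
proof -
  let ?X = "{\<psi>. dirichlet_char q \<psi>}"
  have "coprime (a * b) q" using cong_imp_coprime_iff[OF b] by simp
  then have b': "coprime b q" by simp
  have val: "(\<Sum>\<psi>\<in>?X. \<psi> b * \<psi> n) = (if [n = a] (mod q) then of_nat (card ?X) else 0)" for n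
  proof (cases "coprime n q")
    case True
    have "[b * n = 1] (mod q) \<longleftrightarrow> [n = a] (mod q)"
    proof
      assume "[b * n = 1] (mod q)"
      then have "[b * n = b * a] (mod q)" using b by (metis cong_sym cong_trans mult.commute)
      then show "[n = a] (mod q)" using b' by (simp add: cong_mult_lcancel_nat)
    next
      assume "[n = a] (mod q)"
      then have "[b * n = b * a] (mod q)" by (intro cong_mult cong_refl)
      then show "[b * n = 1] (mod q)" using b by (metis cong_trans mult.commute)
    qed
    moreover have "(\<Sum>\<psi>\<in>?X. \<psi> b * \<psi> n) = (\<Sum>\<psi>\<in>?X. \<psi> (b * n))"
      by (rule sum.cong) (auto simp: dirichlet_charD(1))
    ultimately show ?thesis using sum_dirichlet_chars[OF q, of "b * n"] True b' by simp
  next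
    case False
    then have "\<not> [n = a] (mod q)" using a cong_imp_coprime_iff by blast
    then show ?thesis using False dirichlet_charD(3)[of q] by (auto intro!: sum.neutral)
  qed
  have "(\<Sum>\<psi>\<in>?X. Re (\<Sum>n\<in>{1..N}. \<psi> b * \<psi> n * mangoldt n / of_nat n)) =
      Re (\<Sum>n\<in>{1..N}. \<Sum>\<psi>\<in>?X. \<psi> b * \<psi> n * mangoldt n / of_nat n)"
    by (subst sum.swap) (simp only: Re_sum)
  also have "(\<Sum>n\<in>{1..N}. \<Sum>\<psi>\<in>?X. \<psi> b * \<psi> n * mangoldt n / of_nat n) =
      (\<Sum>n\<in>{1..N}. if [n = a] (mod q) then of_real (real (card ?X) * (mangoldt n / real n)) else 0)"
    by (rule sum.cong[OF refl]) (simp add: val flip: sum_distrib_right sum_divide_distrib)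
  also have "\<dots> = of_real (real (card ?X) * (\<Sum>n | n \<in> {1..N} \<and> [n = a] (mod q). mangoldt n / real n))"
    by (subst sum.inter_filter[symmetric]) (auto simp: sum_distrib_left)
  finally show ?thesis by simp
qed

lemma ln_dominates_constant: "\<exists>N>0. ln (real N) > C"
proof -
  obtain N :: nat where N: "real N > exp C" using reals_Archimedean2 by blast
  have "0 < real N" using exp_gt_zero[of C] N by linarith
  then show ?thesis using N by (metis exp_less_cancel_iff exp_ln of_nat_0_less_iff)
qed

text \<open>A zero at \<open>\<psi>\<close> is also a zero at its conjugate, which is a different
  character because real ones are excluded. Orthogonality at the class of 1 gives a nonnegative
  total, yet these two outweigh the principal character by \<open>ln N\<close>.\<close>

lemma nonprincipal_L_one_nonzero:
  assumes "nonprincipal_char q \<psi>"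
  shows "nonprincipal_char.L_one \<psi> \<noteq> 0"
proof
  assume zero: "nonprincipal_char.L_one \<psi> = 0"
  interpret nonprincipal_char q \<psi> by fact
  define \<psi>' where "\<psi>' = (\<lambda>n. cnj (\<psi> n))"
  define X where "X = {\<psi>. dirichlet_char q \<psi>}"
  have fin: "finite X" unfolding X_def by (rule finite_dirichlet_char[OF q_pos])
  have "principal_char q = (\<lambda>n. cnj (principal_char q n))" by (auto simp: principal_char_def)
  then have "\<psi>' \<noteq> principal_char q"
    using nonprincipal unfolding \<psi>'_def by (metis complex_cnj_cnj ext)
  then interpret c: nonprincipal_char q \<psi>'
    using q_pos dirichlet_char_cnj[OF char] by unfold_locales (auto simp: \<psi>'_def)
  have "c.L_partial N = cnj (L_partial N)" for N
    unfolding c.L_partial_def L_partial_def by (simp add: \<psi>'_def)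
  then have "c.L_partial \<longlonglongrightarrow> cnj L_one" using tendsto_cnj[OF L_partial_tendsto] by presburger
  then have zero': "c.L_one = 0" using c.L_partial_tendsto zero LIMSEQ_unique by fastforce
  have neq: "\<psi> \<noteq> \<psi>'"
  proof
    assume "\<psi> = \<psi>'"
    then have "cnj (\<psi> n) = \<psi> n" for n by (metis \<psi>'_def)
    then show False using L_one_nonzero_real zero by blast
  qed
  \<comment> \<open>An upper bound holds whether or not the value at 1 vanishes: a further zero only
    pushes the sum down by \<open>ln N\<close>.\<close>
  have other: "\<exists>C. \<forall>N>0. char_mangoldt_sum \<phi> N \<le> C" if "\<phi> \<in> X" "\<phi> \<noteq> principal_char q" for \<phi>
  proof -
    interpret d: nonprincipal_char q \<phi> using that q_pos by unfold_locales (auto simp: X_def)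
    have eq: "char_mangoldt_sum \<phi> N = Re (d.mangoldt_partial N)" for N
      by (simp only: char_mangoldt_sum_def d.mangoldt_partial_def)
    show ?thesis
    proof (cases "d.L_one = 0")
      case True
      have "char_mangoldt_sum \<phi> N \<le> 2 * real q" if "N > 0" for N
      proof -
        have "Re (d.mangoldt_partial N + of_real (ln (real N))) \<le> 2 * real q"
          using d.mangoldt_partial_plus_ln_bounded[OF True that] complex_Re_le_cmod order_trans by blast
        moreover have "ln (real N) \<ge> 0" using that by simp
        ultimately show ?thesis by (simp add: eq)
      qed
      then show ?thesis by blast
    next
      case False
      then show ?thesis using d.mangoldt_partial_bounded complex_Re_le_cmod order_trans eq by metis
    qed
  qed
  then obtain C where C: "\<And>\<phi> N. \<phi> \<in> X \<Longrightarrow> \<phi> \<noteq> principal_char q \<Longrightarrow> N > 0 \<Longrightarrow> char_mangoldt_sum \<phi> N \<le> C \<phi>"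
    by metis
  have z1: "char_mangoldt_sum \<psi> N \<le> 2 * real q - ln (real N)" if "N > 0" for N
    using order_trans[OF complex_Re_le_cmod mangoldt_partial_plus_ln_bounded[OF zero that]]
    by (simp add: char_mangoldt_sum_def mangoldt_partial_def)
  have z2: "char_mangoldt_sum \<psi>' N \<le> 2 * real q - ln (real N)" if "N > 0" for N
    using order_trans[OF complex_Re_le_cmod c.mangoldt_partial_plus_ln_bounded[OF zero' that]]
    by (simp add: char_mangoldt_sum_def c.mangoldt_partial_def)
  have z0: "char_mangoldt_sum (principal_char q) N \<le> ln (real N) + 4" if "N > 0" for N
  proof -
    have "char_mangoldt_sum (principal_char q) N \<le> (\<Sum>n\<in>{1..N}. mangoldt n / real n)"
      unfolding char_mangoldt_sum_principal by (rule sum_mono2) (auto simp: mangoldt_nonneg)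
    then show ?thesis using sum_mangoldt_over_le[OF that] by linarith
  qed
  define Y where "Y = X - {principal_char q, \<psi>, \<psi>'}"
  have X_eq: "X = insert (principal_char q) (insert \<psi> (insert \<psi>' Y))"
    using char c.char dirichlet_char_principal by (auto simp: X_def Y_def)
  have tot: "(\<Sum>\<phi>\<in>X. char_mangoldt_sum \<phi> N) =
      char_mangoldt_sum (principal_char q) N + char_mangoldt_sum \<psi> N + char_mangoldt_sum \<psi>' N + (\<Sum>\<phi>\<in>Y. char_mangoldt_sum \<phi> N)" for N
    unfolding X_eq using fin neq nonprincipal c.nonprincipal by (subst sum.insert; simp add: Y_def)+
  have nonneg: "(\<Sum>\<phi>\<in>X. char_mangoldt_sum \<phi> N) \<ge> 0" for N
  proof -
    have "(\<Sum>\<phi>\<in>X. char_mangoldt_sum \<phi> N) =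
        real (card X) * (\<Sum>n | n \<in> {1..N} \<and> [n = 1] (mod q). mangoldt n / real n)"
      using sum_char_mangoldt_sums[OF q_pos, of 1 1 N] unfolding X_def char_mangoldt_sum_def
      by (simp add: dirichlet_charD(4))
    then show ?thesis by (simp add: sum_nonneg mangoldt_nonneg)
  qed
  \<comment> \<open>The 4 comes from the principal character, and \<open>2 * q\<close> from each of
    the two conjugate characters.\<close>
  obtain N where N: "N > 0" "ln (real N) > 4 + 4 * real q + (\<Sum>\<phi>\<in>Y. C \<phi>)"
    using ln_dominates_constant by blast
  have "(\<Sum>\<phi>\<in>Y. char_mangoldt_sum \<phi> N) \<le> (\<Sum>\<phi>\<in>Y. C \<phi>)"
    using N(1) by (intro sum_mono C) (auto simp: Y_def)
  then show False using tot[of N] nonneg[of N] z0[OF N(1)] z1[OF N(1)] z2[OF N(1)] N(2) by linarith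
qed

text \<open>Without a prime in the class, its weighted sum is bounded by the nonprime contribution,
  whereas the principal character makes the same sum grow like \<open>ln N\<close> and all others
  stay bounded.\<close>

theorem dirichlet_prime_exists:
  fixes a q :: nat
  assumes q: "q > 0" and a: "coprime a q"
  shows "\<exists>p. prime p \<and> [p = a] (mod q)"
proof (rule ccontr)
  assume none: "\<not> (\<exists>p. prime p \<and> [p = a] (mod q))"
  obtain b where b: "[a * b = 1] (mod q)" using cong_solve_coprime_nat[OF a] by auto
  define X where "X = {\<psi>. dirichlet_char q \<psi>}"
  define D where "D = (\<lambda>\<psi> N. Re (\<Sum>n\<in>{1..N}. \<psi> b * \<psi> n * mangoldt n / of_nat n))"
  have fin: "finite X" unfolding X_def by (rule finite_dirichlet_char[OF q])
  have bounded: "\<exists>C. \<forall>N. D \<psi> N \<ge> C" if "\<psi> \<in> X" "\<psi> \<noteq> principal_char q" for \<psi>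
  proof -
    interpret d: nonprincipal_char q \<psi> using that q by unfold_locales (auto simp: X_def)
    have "d.L_one \<noteq> 0" by (rule nonprincipal_L_one_nonzero) unfold_locales
    then obtain C where C: "\<And>N. norm (d.mangoldt_partial N) \<le> C" using d.mangoldt_partial_bounded by blast
    have "D \<psi> N \<ge> - C" for N
    proof -
      have "D \<psi> N = Re (\<psi> b * d.mangoldt_partial N)"
        by (simp add: D_def d.mangoldt_partial_def sum_distrib_left mult.assoc)
      moreover have "norm (\<psi> b * d.mangoldt_partial N) \<le> 1 * C"
        unfolding norm_mult by (intro mult_mono norm_dirichlet_char_le[OF d.char q] C) auto
      ultimately show ?thesis using abs_Re_le_cmod[of "\<psi> b * d.mangoldt_partial N"] by linarith
    qed
    then show ?thesis by blast
  qed
  then obtain C where C: "\<And>\<psi> N. \<psi> \<in> X \<Longrightarrow> \<psi> \<noteq> principal_char q \<Longrightarrow> D \<psi> N \<ge> C \<psi>" by metis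
  obtain K where K: "\<And>N. N > 0 \<Longrightarrow> (\<Sum>n | n \<in> {1..N} \<and> coprime n q. mangoldt n / real n) \<ge> ln (real N) - K"
    using principal_mangoldt_sum_ge[OF q] by blast
  obtain K' where K': "\<And>N. (\<Sum>n | n \<in> {1..N} \<and> \<not> prime n. mangoldt n / real n) \<le> K'"
    using sum_mangoldt_over_nonprime_bounded by blast
  have "coprime (a * b) q" using cong_imp_coprime_iff[OF b] by simp
  then have "principal_char q b = 1" by (simp add: principal_char_def)
  then have D0: "D (principal_char q) N \<ge> ln (real N) - K" if "N > 0" for N
    using K[OF that] char_mangoldt_sum_principal[of q N] by (simp add: D_def char_mangoldt_sum_def)
  have upper: "(\<Sum>\<psi>\<in>X. D \<psi> N) \<le> real (card X) * K'" for N
  proof -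
    have "(\<Sum>n | n \<in> {1..N} \<and> [n = a] (mod q). mangoldt n / real n) \<le>
        (\<Sum>n | n \<in> {1..N} \<and> \<not> prime n. mangoldt n / real n)"
      using none by (intro sum_mono2) (auto simp: mangoldt_nonneg)
    also have "\<dots> \<le> K'" by (rule K')
    finally show ?thesis
      using sum_char_mangoldt_sums[OF q a b, of N] unfolding X_def D_def by (simp add: mult_left_mono)
  qed
  define Y where "Y = X - {principal_char q}"
  obtain N where N: "N > 0" "ln (real N) > K + real (card X) * K' - (\<Sum>\<psi>\<in>Y. C \<psi>)"
    using ln_dominates_constant by blast
  have "(\<Sum>\<psi>\<in>X. D \<psi> N) = D (principal_char q) N + (\<Sum>\<psi>\<in>Y. D \<psi> N)"
    unfolding Y_def using fin dirichlet_char_principal by (intro sum.remove) (auto simp: X_def)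
  moreover have "(\<Sum>\<psi>\<in>Y. C \<psi>) \<le> (\<Sum>\<psi>\<in>Y. D \<psi> N)" by (intro sum_mono C) (auto simp: Y_def)
  ultimately show False using D0[OF N(1)] upper[of N] N(2) by linarith
qed

section \<open>Counting congruences modulo powers\<close>

abbreviation (input) primes :: "int set" where
  "primes \<equiv> {p. prime p}"

text \<open>The cutoff \<open>I\<close> keeps the count finite even when \<open>ordb b x\<close> is
  infinite; letting it grow detects that case. The largest level counted is at least the number of
  levels.\<close>

lemma card_divisible_powers_le_ordb: "enat (card {i\<in>{1..I}. int b ^ i dvd x}) \<le> ordb b x"
proof -
  define A where "A = {i\<in>{1..I}. int b ^ i dvd x}"
  have fin: "finite A" by (simp add: A_def)
  have "int b ^ card A dvd x"
  proof (cases "A = {}")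
    case False
    have "A \<subseteq> {1..Max A}" using fin by (auto simp: A_def intro!: Max_ge)
    then have "card A \<le> Max A" using card_mono[of "{1..Max A}" A] by simp
    moreover have "int b ^ Max A dvd x" using Max_in[OF fin False] by (simp add: A_def)
    ultimately show ?thesis using le_imp_power_dvd dvd_trans by blast
  qed simp
  then show ?thesis unfolding ordb_def A_def[symmetric] by (intro Sup_upper) auto
qed

lemma ordb_le_card_divisible_powers:
  assumes "\<not> int b ^ Suc I dvd x"
  shows "ordb b x \<le> enat (card {i\<in>{1..I}. int b ^ i dvd x})"
  unfolding ordb_def
proof (rule Sup_least, clarsimp)
  fix k assume k: "int b ^ k dvd x"
  have "k \<le> I"
  proof (rule ccontr)
    assume "\<not> k \<le> I"
    then have "int b ^ Suc I dvd int b ^ k" by (intro le_imp_power_dvd) auto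
    then show False using k assms dvd_trans by blast
  qed
  moreover have "int b ^ i dvd x" if "i \<le> k" for i using le_imp_power_dvd[OF that] k dvd_trans by blast
  ultimately have "{1..k} \<subseteq> {i\<in>{1..I}. int b ^ i dvd x}" by auto
  then show "k \<le> card {i. Suc 0 \<le> i \<and> i \<le> I \<and> int b ^ i dvd x}"
    using card_mono[of "{i\<in>{1..I}. int b ^ i dvd x}" "{1..k}"] by simp
qed

lemma sum_enat: "(\<Sum>x\<in>A. enat (f x)) = enat (\<Sum>x\<in>A. f x)"
  by (induction A rule: infinite_finite_induct) (simp_all add: zero_enat_def)

lemma sum_card_swap:
  assumes "finite A" "finite B"
  shows "(\<Sum>x\<in>A. card {y\<in>B. R x y}) = (\<Sum>y\<in>B. card {x\<in>A. R x y})"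
  using sum.swap[of "\<lambda>x y. if R x y then 1 else 0 :: nat" B A] assms
  by (simp add: sum.If_cases Int_def)

lemma sum_congruence_counts_le_sum_ordb:
  fixes a :: "nat \<Rightarrow> int"
  shows "enat (\<Sum>i\<in>{1..I}. card {j\<in>{..<k}. int b ^ i dvd x - a j}) \<le> (\<Sum>j<k. ordb b (x - a j))"
proof -
  have "enat (\<Sum>i\<in>{1..I}. card {j\<in>{..<k}. int b ^ i dvd x - a j}) =
      (\<Sum>j<k. enat (card {i\<in>{1..I}. int b ^ i dvd x - a j}))"
    by (subst sum_card_swap) (simp_all add: sum_enat)
  also have "\<dots> \<le> (\<Sum>j<k. ordb b (x - a j))" by (intro sum_mono card_divisible_powers_le_ordb)
  finally show ?thesis .
qed

lemma sum_ordb_le_sum_congruence_counts: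
  fixes a :: "nat \<Rightarrow> int"
  assumes "\<And>j. j < k \<Longrightarrow> \<not> int b ^ Suc I dvd x - a j"
  shows "(\<Sum>j<k. ordb b (x - a j)) \<le> enat (\<Sum>i\<in>{1..I}. card {j\<in>{..<k}. int b ^ i dvd x - a j})"
proof -
  have "(\<Sum>j<k. ordb b (x - a j)) \<le> (\<Sum>j<k. enat (card {i\<in>{1..I}. int b ^ i dvd x - a j}))"
    by (intro sum_mono ordb_le_card_divisible_powers) (use assms in auto)
  also have "\<dots> = enat (\<Sum>i\<in>{1..I}. card {j\<in>{..<k}. int b ^ i dvd x - a j})"
    by (subst sum_card_swap) (simp_all add: sum_enat)
  finally show ?thesis .
qed

section \<open>Pigeonhole bounds and the least number of congruent pairs\<close>

lemma exists_small_class: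
  assumes "finite R" "R \<noteq> {}" "finite J" and disj: "disjoint_family_on B R"
    and sub: "\<And>r. r \<in> R \<Longrightarrow> B r \<subseteq> J"
  shows "\<exists>r\<in>R. card (B r) \<le> card J div card R"
proof (rule ccontr)
  assume "\<not> ?thesis"
  then have "Suc (card J div card R) \<le> card (B r)" if "r \<in> R" for r using that by auto
  then have "(\<Sum>r\<in>R. Suc (card J div card R)) \<le> (\<Sum>r\<in>R. card (B r))" by (rule sum_mono)
  also have "\<dots> = card (\<Union>r\<in>R. B r)"
    using assms(1,3) disj finite_subset[OF sub] by (subst card_UN_disjoint') auto
  also have "\<dots> \<le> card J" using assms(3) sub by (intro card_mono) auto
  finally have "card R * Suc (card J div card R) \<le> card J" by simp
  moreover have "card R > 0" using assms by (simp add: card_gt_0_iff)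
  ultimately show False
    by (metis dividend_less_times_div mult.commute mult_Suc_right not_less add.commute)
qed

text \<open>Among \<open>n + 1\<close> elements some class has more than \<open>n div card R\<close>
  members, since otherwise only \<open>n\<close> could be accommodated. Removing one member of it
  destroys at least \<open>n div card R\<close> pairs, and induction handles the rest.\<close>

lemma congruent_pairs_ge:
  fixes g :: "nat \<Rightarrow> 'a"
  assumes "finite J" "finite R" "g ` J \<subseteq> R"
  shows "(\<Sum>m<card J. m div card R) \<le> card {(l, j). l \<in> J \<and> j \<in> J \<and> l < j \<and> g l = g j}"
  using assms(1,3)
proof (induction "card J" arbitrary: J)
  case (Suc n)
  define pairs where "pairs = (\<lambda>J. {(l, j). l \<in> J \<and> j \<in> J \<and> l < j \<and> g l = g j})"
  have fin: "finite (pairs K)" if "finite K" for K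
    by (rule finite_subset[of _ "K \<times> K"]) (use that in \<open>auto simp: pairs_def\<close>)
  have "\<exists>r\<in>R. card {j\<in>J. g j = r} > n div card R"
  proof (rule ccontr)
    assume "\<not> ?thesis"
    then have "(\<Sum>r\<in>R. card {j\<in>J. g j = r}) \<le> (\<Sum>r\<in>R. n div card R)"
      by (intro sum_mono) (simp add: not_less)
    moreover have "(\<Sum>r\<in>R. card {j\<in>J. g j = r}) = card J"
    proof -
      have "card {r \<in> R. g j = r} = 1" if "j \<in> J" for j
      proof -
        have "{r \<in> R. g j = r} = {g j}" using that Suc.prems(2) by auto
        then show ?thesis by simp
      qed
      then show ?thesis
        using sum_card_swap[OF assms(2) Suc.prems(1), of "\<lambda>r j. g j = r"] by simp
    qed
    ultimately have "Suc n \<le> card R * (n div card R)" using Suc.hyps(2) by simp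
    then show False using times_div_less_eq_dividend[of "card R" n] by linarith
  qed
  then obtain r where r: "r \<in> R" "card {j\<in>J. g j = r} > n div card R" by blast
  then have "{j\<in>J. g j = r} \<noteq> {}" by force
  then obtain x where x: "x \<in> J" "g x = r" by auto
  define K where "K = J - {x}"
  define C where "C = {y\<in>K. g y = r}"
  have "{j\<in>J. g j = r} = insert x C" "x \<notin> C" using x by (auto simp: C_def K_def)
  then have cardC: "card C \<ge> n div card R" using r Suc.prems(1) by (simp add: C_def K_def)
  have cardK: "n = card K" using Suc.hyps(2) x Suc.prems(1) by (simp add: K_def)
  have IH: "(\<Sum>m<n. m div card R) \<le> card (pairs K)"
    using Suc.hyps(1)[OF cardK] Suc.prems cardK by (auto simp: pairs_def K_def)
  \<comment> \<open>Pairs are stored in increasing order, so the partner \<open>y\<close> may stand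
    on either side of the removed \<open>x\<close>.\<close>
  define h where "h = (\<lambda>y. if y < x then (y, x) else (x, y))"
  have "inj_on h C" by (auto simp: inj_on_def h_def C_def K_def split: if_splits)
  then have "card (h ` C) = card C" by (rule card_image)
  moreover have "pairs K \<inter> h ` C = {}" by (auto simp: pairs_def h_def K_def)
  moreover have "pairs K \<union> h ` C \<subseteq> pairs J"
    using x by (auto simp: pairs_def h_def K_def C_def)
  ultimately have "card (pairs K) + card C \<le> card (pairs J)"
    using fin Suc.prems(1) card_mono[of "pairs J" "pairs K \<union> h ` C"]
      card_Un_disjoint[of "pairs K" "h ` C"] by (simp add: K_def C_def)
  moreover have "card J = Suc n" using Suc.hyps(2) by simp
  ultimately show ?case using IH cardC by (simp add: pairs_def)
qed simp

lemma prime_int_dvd_imp_eq: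
  fixes p q :: int
  assumes "prime p" "prime q" "p dvd q"
  shows "p = q"
  using assms primes_dvd_imp_eq by blast

lemma prime_not_coprime_int:
  fixes x :: int
  assumes "prime x" "\<not> coprime x (int b)" "b > 0"
  shows "x \<in> int ` prime_factors b"
proof -
  have "x dvd int b" using assms prime_imp_coprime by blast
  moreover obtain p where "x = int p" "prime p" using assms(1) by (metis prime_int_nat_transfer prime_ge_0_int nat_0_le int_nat_eq)
  ultimately show ?thesis using assms(3) by (auto simp: prime_factors_dvd)
qed

text \<open>A unit class modulo \<open>b\<close> meets only terms coprime to \<open>b\<close>, so
  pigeonhole over the \<open>totient b\<close> unit classes starts from \<open>M\<close>. Each
  further level splits the chosen class into \<open>b\<close> subclasses
  \<open>r + t * b ^ I\<close>, one of which has at most a \<open>b\<close>-th of its terms;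
  iterated floors combine into a single one.\<close>

lemma exists_balanced_residue:
  fixes a :: "nat \<Rightarrow> int" and b k I :: nat
  assumes b: "b \<ge> 2"
  defines "M \<equiv> card {j\<in>{..<k}. coprime (a j) (int b)}"
  shows "\<exists>r. coprime r b \<and>
    (\<forall>i\<in>{1..I}. card {j\<in>{..<k}. int b ^ i dvd int r - a j} \<le> M div (b ^ (i - 1) * totient b))"
proof (induction I)
  case (Suc I)
  show ?case
  proof (cases "I = 0")
    case True
    define B where "B = (\<lambda>r. {j\<in>{..<k}. int b dvd int r - a j})"
    have "\<exists>r\<in>totatives b. card (B r) \<le> card {j\<in>{..<k}. coprime (a j) (int b)} div card (totatives b)"
    proof (rule exists_small_class)
      show "totatives b \<noteq> {}" using b by simp
      show "disjoint_family_on B (totatives b)"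
        unfolding disjoint_family_on_def
      proof (intro ballI impI)
        fix r s assume rs: "r \<in> totatives b" "s \<in> totatives b" "r \<noteq> s"
        have False if "j \<in> B r" "j \<in> B s" for j
        proof -
          have "int b dvd (int r - a j) - (int s - a j)" using that unfolding B_def by (blast intro: dvd_diff)
          then have "[r = s] (mod b)" by (simp add: cong_iff_dvd_diff flip: cong_int_iff)
          moreover have "r < b" "s < b" using rs b totatives_less[of _ b] by simp_all
          ultimately show False using rs(3) by (simp add: cong_less_modulus_unique_nat)
        qed
        then show "B r \<inter> B s = {}" by blast
      qed
      fix r assume r: "r \<in> totatives b"
      show "B r \<subseteq> {j\<in>{..<k}. coprime (a j) (int b)}"
      proof
        fix j assume j: "j \<in> B r"
        then have "[int r = a j] (mod int b)" by (simp add: B_def cong_iff_dvd_diff)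
        moreover have "coprime (int r) (int b)" using r by (simp add: in_totatives_iff)
        ultimately have "coprime (a j) (int b)" by (rule cong_imp_coprime)
        then show "j \<in> {j\<in>{..<k}. coprime (a j) (int b)}" using j by (simp add: B_def)
      qed
    qed auto
    then show ?thesis using True unfolding B_def M_def
      by (auto simp: in_totatives_iff totient_def)
  next
    case False
    obtain r where r: "coprime r b"
      "\<And>i. i \<in> {1..I} \<Longrightarrow> card {j\<in>{..<k}. int b ^ i dvd int r - a j} \<le> M div (b ^ (i - 1) * totient b)"
      using Suc by blast
    define J where "J = {j\<in>{..<k}. int b ^ I dvd int r - a j}"
    define B where "B = (\<lambda>t. {j\<in>{..<k}. int b ^ Suc I dvd int (r + t * b ^ I) - a j})"
    have "\<exists>t\<in>{..<b}. card (B t) \<le> card J div card {..<b}"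
    proof (rule exists_small_class)
      show "{..<b} \<noteq> {}" using b by (auto simp: lessThan_empty_iff)
      show "finite J" by (simp add: J_def)
      show "disjoint_family_on B {..<b}"
        unfolding disjoint_family_on_def
      proof (intro ballI impI)
        fix t s assume ts: "t \<in> {..<b}" "s \<in> {..<b}" "t \<noteq> s"
        have False if "j \<in> B t" "j \<in> B s" for j
        proof -
          have "int b ^ Suc I dvd (int (r + t * b ^ I) - a j) - (int (r + s * b ^ I) - a j)"
            using that unfolding B_def by (blast intro: dvd_diff)
          then have "int b * int b ^ I dvd (int t - int s) * int b ^ I" by (simp add: algebra_simps)
          then have "int b dvd int t - int s" using b by simp
          then have "[t = s] (mod b)" by (simp add: cong_iff_dvd_diff flip: cong_int_iff)
          then show False using ts by (simp add: cong_less_modulus_unique_nat)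
        qed
        then show "B t \<inter> B s = {}" by blast
      qed
      fix t
      show "B t \<subseteq> J"
      proof
        fix j assume j: "j \<in> B t"
        then have "int b ^ Suc I dvd int (r + t * b ^ I) - a j" unfolding B_def by blast
        then have "int b ^ I dvd int (r + t * b ^ I) - a j"
          by (rule dvd_trans[rotated]) (intro le_imp_power_dvd, simp)
        then have "int b ^ I dvd (int (r + t * b ^ I) - a j) - int t * int b ^ I"
            by (rule dvd_diff) simp
        then show "j \<in> J" using j by (simp add: J_def B_def)
      qed
    qed simp
    then obtain t where t: "card (B t) \<le> card J div b" by auto
    have "card J div b \<le> M div (b ^ (I - 1) * totient b) div b"
      using r(2)[of I] False unfolding J_def by (intro div_le_mono) simp
    also have "\<dots> = M div (b ^ I * totient b)"
      using False by (cases I) (simp_all add: div_mult2_eq[symmetric] mult_ac)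
    finally have last: "card (B t) \<le> M div (b ^ I * totient b)" using t by linarith
    \<comment> \<open>Lifting by a multiple of \<open>b ^ I\<close> leaves the counts at all earlier
      levels unchanged.\<close>
    have dvd_eq: "int b ^ i dvd int (r + t * b ^ I) - x \<longleftrightarrow> int b ^ i dvd int r - x" if "i \<le> I" for i x
    proof -
      have "int b ^ i dvd int t * int b ^ I" using le_imp_power_dvd[OF that, of "int b"] by (rule dvd_mult)
      then have "int b ^ i dvd (int r - x) + int t * int b ^ I \<longleftrightarrow> int b ^ i dvd int r - x"
        by (rule dvd_add_left_iff)
      then show ?thesis by (simp add: algebra_simps)
    qed
    have "coprime (r + t * b ^ I) b"
    proof (rule cong_imp_coprime[OF _ r(1)])
      have "b dvd t * b ^ I" using False by (cases I) auto
      then have "[t * b ^ I = 0] (mod b)" by (simp only: cong_0_iff)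
      from cong_add[OF cong_refl cong_sym[OF this], of r] show "[r = r + t * b ^ I] (mod b)" by simp
    qed
    moreover have "card {j\<in>{..<k}. int b ^ i dvd int (r + t * b ^ I) - a j} \<le> M div (b ^ (i - 1) * totient b)"
      if "i \<in> {1..Suc I}" for i
    proof (cases "i = Suc I")
      case True
      then show ?thesis using last by (simp add: B_def)
    next
      case False
      then show ?thesis using that r(2)[of i] dvd_eq[of i] by simp
    qed
    ultimately show ?thesis by blast
  qed
qed (auto intro: exI[of _ 1])

section \<open>The exponent sequence of the primes\<close>

definition prime_exponent :: "nat \<Rightarrow> nat \<Rightarrow> nat" where
  "prime_exponent b k = (\<Sum>i<k. (k - omega b) div (b ^ i * totient b))"

lemma less_power_nat:
  assumes "b \<ge> (2 :: nat)"
  shows "n < b ^ n"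
  using assms less_exp[of n] power_mono[of 2 b n] by linarith

lemma power_mult_totient_ge: "b > 0 \<Longrightarrow> b ^ i \<le> b ^ i * totient b"
  by (simp add: Suc_le_eq)

lemma sum_floors_eq:
  assumes b: "b \<ge> 2" and "m \<le> I" "m \<le> I'"
  shows "(\<Sum>i<I. m div (b ^ i * totient b)) = (\<Sum>i<I'. m div (b ^ i * totient b))"
proof -
  have *: "(\<Sum>i<I. m div (b ^ i * totient b)) = (\<Sum>i<m. m div (b ^ i * totient b))" if "m \<le> I" for I
  proof (rule sum.mono_neutral_right)
    show "\<forall>i\<in>{..<I} - {..<m}. m div (b ^ i * totient b) = 0"
    proof
      fix i assume "i \<in> {..<I} - {..<m}"
      then have "m < b ^ i" using less_power_nat[OF b, of i] by simp
      then have "m < b ^ i * totient b" using power_mult_totient_ge[of b i] b by linarith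
      then show "m div (b ^ i * totient b) = 0" by simp
    qed
  qed (use that in auto)
  show ?thesis using *[OF assms(2)] *[OF assms(3)] by simp
qed

lemma prime_exponent_eq:
  "b \<ge> 2 \<Longrightarrow> k - omega b \<le> I \<Longrightarrow> prime_exponent b k = (\<Sum>i<I. (k - omega b) div (b ^ i * totient b))"
  unfolding prime_exponent_def by (rule sum_floors_eq) auto

lemma floor_series_eq_prime_exponent:
  assumes b: "b \<ge> 2"
  shows "floor_series b (k - omega b) = enat (prime_exponent b k)"
  unfolding floor_series_def
proof (rule antisym)
  show "(SUP n. enat (\<Sum>i<n. (k - omega b) div (b ^ i * totient b))) \<le> enat (prime_exponent b k)"
  proof (rule SUP_least)
    fix n
    have "(\<Sum>i<n. (k - omega b) div (b ^ i * totient b)) \<le> (\<Sum>i<n + k. (k - omega b) div (b ^ i * totient b))"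
      by (rule sum_mono2) auto
    also have "\<dots> = prime_exponent b k" using b by (subst prime_exponent_eq[of b k "n + k"]) auto
    finally show "enat (\<Sum>i<n. (k - omega b) div (b ^ i * totient b)) \<le> enat (prime_exponent b k)" by simp
  qed
  show "enat (prime_exponent b k) \<le> (SUP n. enat (\<Sum>i<n. (k - omega b) div (b ^ i * totient b)))"
    unfolding prime_exponent_def by (rule SUP_upper) simp
qed

lemma prime_exponent_eq_0_iff:
  assumes "b \<ge> 2"
  shows "prime_exponent b k = 0 \<longleftrightarrow> \<not> totient b + omega b \<le> k"
proof -
  have t: "totient b > 0" using assms by simp
  show ?thesis
  proof (cases "totient b + omega b \<le> k")
    case True
    have "(k - omega b) div (b ^ 0 * totient b) > 0"
      using True t by (simp add: div_greater_zero_iff)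
    moreover have "0 < k" using True t by linarith
    then have "(k - omega b) div (b ^ 0 * totient b) \<le> (\<Sum>i<k. (k - omega b) div (b ^ i * totient b))"
      by (intro member_le_sum) auto
    ultimately have "(\<Sum>i<k. (k - omega b) div (b ^ i * totient b)) \<noteq> 0" by linarith
    then show ?thesis using True by (simp add: prime_exponent_def)
  next
    case False
    have "(k - omega b) div (b ^ i * totient b) = 0" for i
    proof -
      have "k - omega b < totient b" using False t by linarith
      also have "\<dots> \<le> b ^ i * totient b" using assms by simp
      finally show ?thesis by simp
    qed
    then show ?thesis using False by (simp add: prime_exponent_def)
  qed
qed

section \<open>Upper and lower bounds for the costs\<close>

lemma card_coprime_le:
  fixes a :: "nat \<Rightarrow> int"
  assumes used: "int ` prime_factors b \<subseteq> a ` {..<k}" and b: "b > 0"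
  shows "card {j\<in>{..<k}. coprime (a j) (int b)} \<le> k - omega b"
proof -
  let ?J = "{j\<in>{..<k}. coprime (a j) (int b)}"
  have "int ` prime_factors b \<subseteq> a ` ({..<k} - ?J)"
  proof
    fix x assume x: "x \<in> int ` prime_factors b"
    then obtain j where j: "j < k" "x = a j" using used by auto
    from x obtain p where p: "x = int p" "prime p" "p dvd b" by (auto simp: in_prime_factors_iff)
    have "\<not> coprime p b" using p by (metis coprime_absorb_left not_prime_unit)
    then have "\<not> coprime x (int b)" using p by simp
    then show "x \<in> a ` ({..<k} - ?J)" using j by auto
  qed
  then have "card (int ` prime_factors b) \<le> card ({..<k} - ?J)"
    by (meson card_image_le card_mono finite_Diff finite_imageI finite_lessThan order_trans)
  moreover have "card (int ` prime_factors b) = omega b" by (simp add: card_image omega_def)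
  moreover have "card ({..<k} - ?J) = k - card ?J" by (subst card_Diff_subset) auto
  moreover have "card ?J \<le> k" by (rule order_trans[OF card_mono[of "{..<k}"]]) auto
  ultimately show ?thesis by linarith
qed

lemma exists_prime_small_ordb_sum:
  fixes a :: "nat \<Rightarrow> int"
  assumes b: "b \<ge> 2" and a: "\<And>j. prime (a j)"
  shows "\<exists>x\<in>primes. (\<Sum>j<k. ordb b (x - a j)) \<le> enat (prime_exponent b k)"
proof (cases "int ` prime_factors b \<subseteq> a ` {..<k}")
  case False
  then obtain p where p: "p \<in> prime_factors b" "int p \<notin> a ` {..<k}" by auto
  then have pp: "prime (int p)" "p dvd b" by (auto simp: in_prime_factors_iff)
  \<comment> \<open>A congruence modulo \<open>b\<close> would make \<open>p\<close> divide the
    prime \<open>a j\<close>, hence equal it; so not even the first level counts.\<close>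
  have "\<not> int b ^ Suc 0 dvd int p - a j" if "j < k" for j
  proof
    assume "int b ^ Suc 0 dvd int p - a j"
    then have "int p dvd int p - a j" using pp(2) by (metis dvd_trans int_dvd_int_iff power_one_right One_nat_def)
    then have "int p dvd int p - (int p - a j)" by (rule dvd_diff[OF dvd_refl])
    then have "int p = a j" using prime_int_dvd_imp_eq[OF pp(1) a] by simp
    then show False using p(2) that by auto
  qed
  then have "(\<Sum>j<k. ordb b (int p - a j)) \<le> enat 0"
    using sum_ordb_le_sum_congruence_counts[of k b 0 "int p" a] by simp
  then show ?thesis using pp(1) by (intro bexI[of _ "int p"]) (auto intro: order_trans)
next
  case True
  define M where "M = card {j\<in>{..<k}. coprime (a j) (int b)}"
  have M: "M \<le> k - omega b" unfolding M_def using card_coprime_le[OF True] b by simp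
  obtain r where r: "coprime r b"
    "\<And>i. i \<in> {1..Suc k} \<Longrightarrow> card {j\<in>{..<k}. int b ^ i dvd int r - a j} \<le> M div (b ^ (i - 1) * totient b)"
    using exists_balanced_residue[OF b, where k = k and a = a and I = "Suc k"] unfolding M_def by blast
  \<comment> \<open>The extra level \<open>Suc k\<close> admits no coincidence at all, because its
    quotient is 0. This makes every valuation finite and in particular \<open>p\<close> new.\<close>
  obtain p where p: "prime p" "[p = r] (mod b ^ Suc k)"
    using dirichlet_prime_exists[of "b ^ Suc k" r] r(1) b by auto
  have dvd_eq: "int b ^ i dvd int p - x \<longleftrightarrow> int b ^ i dvd int r - x" if "i \<le> Suc k" for i x
  proof -
    have "int b ^ Suc k dvd int p - int r"
      using p(2) by (metis cong_iff_dvd_diff cong_int_iff of_nat_power)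
    then have "int b ^ i dvd int p - int r" using le_imp_power_dvd[OF that] dvd_trans by blast
    then have "int b ^ i dvd (int r - x) + (int p - int r) \<longleftrightarrow> int b ^ i dvd int r - x"
      by (rule dvd_add_left_iff)
    then show ?thesis by simp
  qed
  have count: "card {j\<in>{..<k}. int b ^ i dvd int p - a j} \<le> (k - omega b) div (b ^ (i - 1) * totient b)"
    if "i \<in> {1..Suc k}" for i
    using r(2)[OF that] that div_le_mono[OF M, of "b ^ (i - 1) * totient b"] dvd_eq[of i] by simp
  have "k < b ^ k" by (rule less_power_nat[OF b])
  also have "\<dots> \<le> b ^ k * totient b" using b by (intro power_mult_totient_ge) simp
  finally have "(k - omega b) div (b ^ k * totient b) = 0" by simp
  then have "card {j\<in>{..<k}. int b ^ Suc k dvd int p - a j} = 0" using count[of "Suc k"] by simp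
  then have "\<not> int b ^ Suc k dvd int p - a j" if "j < k" for j using that by auto
  then have "(\<Sum>j<k. ordb b (int p - a j)) \<le> enat (\<Sum>i\<in>{1..k}. card {j\<in>{..<k}. int b ^ i dvd int p - a j})"
    by (rule sum_ordb_le_sum_congruence_counts)
  also have "(\<Sum>i\<in>{1..k}. card {j\<in>{..<k}. int b ^ i dvd int p - a j}) \<le>
      (\<Sum>i\<in>{1..k}. (k - omega b) div (b ^ (i - 1) * totient b))"
    by (intro sum_mono count) auto
  also have "\<dots> = prime_exponent b k"
    unfolding prime_exponent_def by (rule sum.reindex_bij_witness[of _ Suc "\<lambda>i. i - 1"]) auto
  finally show ?thesis using p(1) by (intro bexI[of _ "int p"]) auto
qed

text \<open>Distinct primes not coprime to \<open>b\<close> are among its \<open>omega b\<close>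
  prime divisors, so at least \<open>n - omega b\<close> terms lie in the
  \<open>b ^ (i - 1) * totient b\<close> unit classes modulo \<open>b ^ i\<close>. Their congruent
  pairs alone reach the bound.\<close>

lemma sum_congruence_counts_ge:
  fixes a :: "nat \<Rightarrow> int"
  assumes b: "b \<ge> 2" and i: "i \<ge> 1" and prime: "\<And>j. prime (a j)" and inj: "inj_on a {..<n}"
  shows "(\<Sum>j<n. (j - omega b) div (b ^ (i - 1) * totient b)) \<le>
    (\<Sum>j<n. card {l\<in>{..<j}. int b ^ i dvd a j - a l})"
proof -
  define J where "J = {j\<in>{..<n}. coprime (a j) (int b)}"
  define C where "C = b ^ (i - 1) * totient b"
  define g where "g = (\<lambda>j. nat (a j mod int (b ^ i)))"
  have b0: "b > 0" using b by simp
  have bi: "b ^ i \<ge> 2" using b i self_le_power[of b i] by linarith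
  then have bi0: "0 < int (b ^ i)" by linarith
  have cardR: "card (totatives (b ^ i)) = C"
    using totient_power[of i b] i by (simp add: totient_def C_def)
  have img: "g ` J \<subseteq> totatives (b ^ i)"
  proof
    fix y assume "y \<in> g ` J"
    then obtain j where j: "j < n" "coprime (a j) (int b)" "y = g j" by (auto simp: J_def)
    have y: "int y = a j mod int (b ^ i)" using j(3) pos_mod_sign[OF bi0, of "a j"] by (simp add: g_def)
    have "[a j = int y] (mod int (b ^ i))" by (simp add: y cong_def)
    moreover have "coprime (a j) (int (b ^ i))" using j by simp
    ultimately have "coprime (int y) (int (b ^ i))" by (metis cong_imp_coprime)
    then have cop: "coprime y (b ^ i)" by (simp only: coprime_int_iff)
    moreover have "y < b ^ i" using y bi by (metis of_nat_0_less_iff of_nat_less_iff pos_mod_bound zero_less_numeral order_less_le_trans)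
    moreover have "y > 0" using cop bi by (cases y) auto
    ultimately show "y \<in> totatives (b ^ i)" by (simp add: in_totatives_iff)
  qed
  have g_eq: "g l = g j \<longleftrightarrow> int b ^ i dvd a j - a l" for l j
  proof -
    have "g l = g j \<longleftrightarrow> a l mod int (b ^ i) = a j mod int (b ^ i)"
      unfolding g_def using pos_mod_sign[OF bi0] by (intro eq_nat_nat_iff)
    also have "\<dots> \<longleftrightarrow> int b ^ i dvd a j - a l" by (simp add: mod_eq_dvd_iff dvd_diff_commute)
    finally show ?thesis .
  qed
  have "a ` ({..<n} - J) \<subseteq> int ` prime_factors b"
    using prime_not_coprime_int[OF prime _ b0] by (auto simp: J_def)
  then have "card (a ` ({..<n} - J)) \<le> omega b"
    using card_mono[of "int ` prime_factors b"] by (simp add: card_image omega_def)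
  moreover have "card (a ` ({..<n} - J)) = card ({..<n} - J)"
    by (rule card_image) (use inj in \<open>auto intro: inj_on_subset\<close>)
  moreover have "card ({..<n} - J) = n - card J" by (subst card_Diff_subset) (auto simp: J_def)
  ultimately have cardJ: "n - omega b \<le> card J" by linarith
  \<comment> \<open>Indices below \<open>omega b\<close> contribute 0 by truncated subtraction, and
    the others are shifted to start at 0.\<close>
  have "(\<Sum>j<n. (j - omega b) div C) = (\<Sum>j\<in>{omega b..<n}. (j - omega b) div C)"
    by (rule sum.mono_neutral_right) auto
  also have "\<dots> = (\<Sum>m<n - omega b. m div C)"
    by (rule sum.reindex_bij_witness[of _ "\<lambda>m. m + omega b" "\<lambda>j. j - omega b"]) auto
  also have "\<dots> \<le> (\<Sum>m<card J. m div C)" using cardJ by (intro sum_mono2) auto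
  also have "\<dots> \<le> card {(l, j). l \<in> J \<and> j \<in> J \<and> l < j \<and> g l = g j}"
    using congruent_pairs_ge[of J "totatives (b ^ i)" g] img cardR by (simp add: J_def)
  also have "\<dots> = card ((\<lambda>(l, j). (j, l)) ` {(l, j). l \<in> J \<and> j \<in> J \<and> l < j \<and> g l = g j})"
    by (rule card_image[symmetric]) (auto simp: inj_on_def)
  also have "\<dots> \<le> card (SIGMA j:{..<n}. {l\<in>{..<j}. int b ^ i dvd a j - a l})"
    by (rule card_mono) (auto simp: J_def g_eq)
  also have "\<dots> = (\<Sum>j<n. card {l\<in>{..<j}. int b ^ i dvd a j - a l})" by simp
  finally show ?thesis by (simp add: C_def)
qed

lemma b_ordering_primes_sum:
  assumes b: "b \<ge> 2" and ord: "b_ordering primes b a"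
  shows "(\<Sum>j<k. ordb b (a k - a j)) = enat (prime_exponent b k)"
proof -
  have prime: "prime (a j)" for j using ord by (simp add: b_ordering_def)
  have upper: "(\<Sum>j<n. ordb b (a n - a j)) \<le> enat (prime_exponent b n)" for n
  proof (cases "n = 0")
    case False
    obtain x where "x \<in> primes" "(\<Sum>j<n. ordb b (x - a j)) \<le> enat (prime_exponent b n)"
      using exists_prime_small_ordb_sum[OF b, of a n] prime by blast
    moreover have "(\<Sum>j<n. ordb b (a n - a j)) \<le> (\<Sum>j<n. ordb b (x - a j))"
      using ord False \<open>x \<in> primes\<close> by (simp add: b_ordering_def)
    ultimately show ?thesis by (meson order_trans)
  qed (simp add: zero_enat_def)
  \<comment> \<open>Equal terms agree at every level, so a cutoff one above the upper bound on the
    cost is already contradictory. The lower bound on pairs relies on this injectivity.\<close>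
  have neq: "a n \<noteq> a j" if "j < n" for n j
  proof
    assume eq: "a n = a j"
    define I where "I = Suc (prime_exponent b n)"
    have "{i\<in>{1..I}. int b ^ i dvd a n - a j} = {1..I}" by (auto simp: eq)
    then have "enat I = enat (card {i\<in>{1..I}. int b ^ i dvd a n - a j})" by simp
    also have "\<dots> \<le> ordb b (a n - a j)" by (rule card_divisible_powers_le_ordb)
    also have "\<dots> \<le> (\<Sum>j<n. ordb b (a n - a j))" using that by (intro member_le_sum) auto
    also have "\<dots> \<le> enat (prime_exponent b n)" by (rule upper)
    finally show False by (simp add: I_def)
  qed
  have inj: "inj_on a {..<n}" for n by (rule inj_onI) (metis neq linorder_neqE_nat)
  define u where "u = (\<lambda>n. the_enat (\<Sum>j<n. ordb b (a n - a j)))"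
  have u: "(\<Sum>j<n. ordb b (a n - a j)) = enat (u n)" for n
    using enat_ile[OF upper[of n]] by (auto simp: u_def)
  have le: "u n \<le> prime_exponent b n" for n using upper[of n] unfolding u by simp
  define N where "N = (\<lambda>n i. card {j\<in>{..<n}. int b ^ i dvd a n - a j})"
  \<comment> \<open>A common range of \<open>k\<close> levels serves all \<open>n \<le> k\<close>,
    which allows the sums over levels and indices to be interchanged.\<close>
  have "(\<Sum>n<Suc k. prime_exponent b n) = (\<Sum>n<Suc k. \<Sum>i\<in>{1..k}. (n - omega b) div (b ^ (i - 1) * totient b))"
  proof (rule sum.cong[OF refl])
    fix n assume "n \<in> {..<Suc k}"
    then have "prime_exponent b n = (\<Sum>i<k. (n - omega b) div (b ^ i * totient b))"
      by (intro prime_exponent_eq[OF b]) auto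
    also have "\<dots> = (\<Sum>i\<in>{1..k}. (n - omega b) div (b ^ (i - 1) * totient b))"
      by (rule sum.reindex_bij_witness[of _ "\<lambda>i. i - 1" Suc]) auto
    finally show "prime_exponent b n = (\<Sum>i\<in>{1..k}. (n - omega b) div (b ^ (i - 1) * totient b))" .
  qed
  also have "\<dots> = (\<Sum>i\<in>{1..k}. \<Sum>n<Suc k. (n - omega b) div (b ^ (i - 1) * totient b))" by (rule sum.swap)
  also have "\<dots> \<le> (\<Sum>i\<in>{1..k}. \<Sum>n<Suc k. N n i)"
    unfolding N_def by (intro sum_mono sum_congruence_counts_ge[OF b _ prime inj]) auto
  also have "\<dots> = (\<Sum>n<Suc k. \<Sum>i\<in>{1..k}. N n i)" by (rule sum.swap)
  also have "\<dots> \<le> (\<Sum>n<Suc k. u n)"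
  proof (rule sum_mono)
    fix n
    have "enat (\<Sum>i\<in>{1..k}. N n i) \<le> enat (u n)"
      unfolding N_def u[symmetric] by (rule sum_congruence_counts_le_sum_ordb)
    then show "(\<Sum>i\<in>{1..k}. N n i) \<le> u n" by simp
  qed
  finally have "(\<Sum>n<Suc k. prime_exponent b n) \<le> (\<Sum>n<Suc k. u n)" .
  \<comment> \<open>The total up to \<open>k\<close> is bounded below and the total before
    \<open>k\<close> above; the difference isolates the cost at \<open>k\<close>.\<close>
  moreover have "(\<Sum>n<k. u n) \<le> (\<Sum>n<k. prime_exponent b n)" by (intro sum_mono le)
  ultimately have "prime_exponent b k \<le> u k" by simp
  then show ?thesis using le[of k] u[of k] by simp
qed

section \<open>Existence of orderings and the factorial formula\<close>

lemma exists_b_ordering: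
  assumes "S \<noteq> {}"
  shows "\<exists>a. b_ordering S b a"
proof -
  define P where "P = (\<lambda>f (i :: nat) r. r \<in> S \<and>
    (\<forall>a'\<in>S. (\<Sum>j<i. ordb b (r - f j)) \<le> (\<Sum>j<i. ordb b (a' - f j))))"
  have "\<exists>f. \<forall>i. P f i (f i)"
  proof (rule dependent_wellorder_choice[where P = P])
    fix r :: int and f g :: "nat \<Rightarrow> int" and i :: nat assume eq: "\<And>y. y < i \<Longrightarrow> f y = g y"
    have "(\<Sum>j<i. ordb b (x - f j)) = (\<Sum>j<i. ordb b (x - g j))" for x by (rule sum.cong) (use eq in auto)
    then show "P f i r = P g i r" by (simp add: P_def)
  next
    fix i :: nat and f :: "nat \<Rightarrow> int"
    define cost where "cost = (\<lambda>x. \<Sum>j<i. ordb b (x - f j))"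
    \<comment> \<open>The type \<open>enat\<close> is well-ordered, so the minimal cost is attained
      on an infinite set as well.\<close>
    define m where "m = (LEAST m. m \<in> cost ` S)"
    have "m \<in> cost ` S" unfolding m_def by (rule LeastI_ex) (use assms in blast)
    then obtain r where r: "r \<in> S" "cost r = m" by blast
    have "cost r \<le> cost x" if "x \<in> S" for x
      unfolding r(2) m_def using that by (intro Least_le) blast
    then show "\<exists>r. P f i r" unfolding P_def using r(1) by (auto simp: cost_def)
  qed
  then show ?thesis by (auto simp: b_ordering_def P_def)
qed

text \<open>Every ordering has the same costs, so the one selected by \<open>SOME\<close> is as good
  as any, provided that one exists.\<close>

lemma alpha_primes:
  assumes "b \<ge> 2"
  shows "alpha primes b k = enat (prime_exponent b k)"
proof -
  have "primes \<noteq> {}" using two_is_prime_nat by (auto intro: exI[of _ 2])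
  then have "b_ordering primes b (SOME a. b_ordering primes b a)"
    by (rule someI_ex[OF exists_b_ordering])
  then show ?thesis unfolding alpha_def Let_def by (rule b_ordering_primes_sum[OF assms])
qed

theorem theorem3p9:
  fixes T :: "nat set" and k :: nat
  assumes "0 \<notin> T"
  shows "gen_fact {p::int. prime p} T k =
    (\<Prod>b\<in>{b\<in>T. totient b + omega b \<le> k}. epow b (floor_series b (k - omega b)))"
proof -
  define A where "A = {b\<in>T. epow b (alpha primes b k) \<noteq> 1}"
  define B where "B = {b\<in>T. totient b + omega b \<le> k}"
  \<comment> \<open>The base 1 contributes 1 even when its exponent is infinite. The left product
    omits it by definition, and the right one may contain it.\<close>
  have epow_1: "epow (Suc 0) e = 1" for e by (simp add: epow_def split: enat.split)
  have val: "alpha primes b k = floor_series b (k - omega b)"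
    "epow b (alpha primes b k) = 1 \<longleftrightarrow> \<not> totient b + omega b \<le> k" if "b \<ge> 2" for b
    using that by (simp_all add: alpha_primes floor_series_eq_prime_exponent epow_def
        prime_exponent_eq_0_iff[symmetric])
  have pos: "b = 1 \<or> b \<ge> 2" if "b \<in> T" for b using that assms by (cases "b = 0") auto
  have A_eq: "A = B - {1}" unfolding A_def B_def using val(2) pos epow_1 by fastforce
  have "gen_fact primes T k = (\<Prod>b\<in>A. epow b (alpha primes b k))"
    by (simp add: gen_fact_def A_def)
  also have "\<dots> = (\<Prod>b\<in>B - {1}. epow b (floor_series b (k - omega b)))"
    unfolding A_eq
  proof (rule prod.cong[OF refl])
    fix b assume "b \<in> B - {1}"
    then have "b \<ge> 2" using pos by (auto simp: B_def)
    then show "epow b (alpha primes b k) = epow b (floor_series b (k - omega b))" by (simp only: val(1))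
  qed
  also have "\<dots> = (\<Prod>b\<in>B. epow b (floor_series b (k - omega b)))"
  proof (cases "finite B")
    case True
    then show ?thesis by (intro prod.mono_neutral_left) (auto simp: epow_1)
  next
    \<comment> \<open>By convention a product over an infinite set is 1, and removing one element
      keeps \<open>B\<close> infinite, so both sides agree.\<close>
    case False
    then show ?thesis by simp
  qed
  finally show ?thesis by (simp only: B_def)
qed

end
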